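(* Let $\mathfrak M_i$ and $\mathfrak N_i$ ($1\le i\le k$) be $\mathsf{FO(TC^1)}$-Henkin structures over $\sigma$, the $\mathfrak M_i$ with pairwise disjoint domains and the $\mathfrak N_i$ with pairwise disjoint domains. For $1\le i\le k$ let $\bar a_i,\bar b_i$ be sequences of first-order parameters $a_{i_1},\ldots,a_{i_m}$ in $\mathfrak M_i$ and $b_{i_1},\ldots,b_{i_m}$ in $\mathfrak N_i$ (with $m$ possibly depending on $i$), where each sequence $\bar a_i$ (respectively $\bar b_i$) contains at least two distinct elements unless $\mathfrak M_i$ (respectively $\mathfrak N_i$) has only one element. If $(\mathfrak M_i,\bar a_i)\equiv^n_{\mathsf{FO(TC^1)}}(\mathfrak N_i,\bar b_i)$ for all $1\le i\le k$, then $$\Big(\bigoplus^f_{1\le i\le k}\mathfrak M_i,\bar a_1,\ldots,\bar a_k\Big)\equiv^n_{\mathsf{FO(TC^1)}}\Big(\bigoplus^f_{1\le i\le k}\mathfrak N_i,\bar b_1,\ldots,\bar b_k\Big).$$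
   Context: $\mathsf{FO(TC^1)}$ extends first-order logic with formulas $[TC_{xy}\varphi](u,v)$; quantifier depth counts nested first-order quantifiers and $TC$ operators; $\equiv^n_{\mathsf{FO(TC^1)}}$ between parametrized structures means satisfying the same $\mathsf{FO(TC^1)}$-formulas of quantifier depth at most $n$ with corresponding parameters. Henkin semantics: a frame is a relational structure $\mathfrak M$ with admissible sets $\mathbb A_{\mathfrak M}\subseteq\wp(dom(\mathfrak M))$; $[TC_{xy}\varphi](u,v)$ holds under $g$ iff $g(v)$ belongs to every $A\in\mathbb A_{\mathfrak M}$ with $g(u)\in A$ that is closed under $\varphi$ ($a\in A$ and $\mathfrak M,g[a/x,b/y]\models\varphi$ imply $b\in A$). An $\mathsf{FO(TC^1)}$-Henkin structure is a frame in which every set $\{a:\mathfrak M,g[a/x]\models\varphi\}$ ($\varphi$ an $\mathsf{FO(TC^1)}$-formula) is admissible. Fusion. $\sigma$ is purely relational, $\sigma^*=\sigma\cup\{Q_1,\ldots,Q_k\}$ with new unary $Q_i$, and $f$ maps each $n$-ary $P\in\sigma$ to a quantifier-free first-order $\sigma^*$-formula in $x_1,\ldots,x_n$. For structures with pairwise disjoint domains, $\biguplus_i\mathfrak M_i$ is the $\sigma^*$-frame with domain $\bigcup_idom(\mathfrak M_i)$, $P\in\sigma$ interpreted as $\bigcup_iP^{\mathfrak M_i}$, $Q_i$ as $dom(\mathfrak M_i)$, admissible sets the sets $\bigcup_iA_i$ with $A_i\in\mathbb A_{\mathfrak M_i}$. The $f$-fusion $\bigoplus^f_i\mathfrak M_i$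 is the $\sigma$-frame with the same domain and admissible sets, each $P\in\sigma$ interpreted as the tuples satisfying $f(P)$ in $\biguplus_i\mathfrak M_i$. *)

theory Defs
  imports Main "HOL-Library.Disjoint_Sets"
begin

text \<open>
  A relational signature is a partial map from symbols to arities. Variables are natural numbers;
  as signatures are purely relational, they are the only terms. The missing connectives and the
  universal quantifier are the usual abbreviations; these do not affect quantifier depth.
\<close>

type_synonym 'p signature = "'p \<rightharpoonup> nat"

datatype 'p form =
    Bot
  | Eq nat nat
  | Rel 'p "nat list"
  | Neg "'p form"
  | Conj "'p form" "'p form"
  | Ex nat "'p form"
  | TC nat nat "'p form" nat nat  \<comment> \<open>\<open>TC x y \<phi> u v\<close> is \<open>[TC\<^bsub>xy\<^esub> \<phi>](u,v)\<close>; it binds \<open>x\<close> and \<open>y\<close> in \<open>\<phi>\<close>\<close>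

primrec wf_form :: "'p signature \<Rightarrow> 'p form \<Rightarrow> bool" where
  "wf_form \<sigma> Bot \<longleftrightarrow> True"
| "wf_form \<sigma> (Eq x y) \<longleftrightarrow> True"
| "wf_form \<sigma> (Rel P xs) \<longleftrightarrow> \<sigma> P = Some (length xs)"
| "wf_form \<sigma> (Neg \<phi>) \<longleftrightarrow> wf_form \<sigma> \<phi>"
| "wf_form \<sigma> (Conj \<phi> \<psi>) \<longleftrightarrow> wf_form \<sigma> \<phi> \<and> wf_form \<sigma> \<psi>"
| "wf_form \<sigma> (Ex x \<phi>) \<longleftrightarrow> wf_form \<sigma> \<phi>"
| "wf_form \<sigma> (TC x y \<phi> u v) \<longleftrightarrow> x \<noteq> y \<and> wf_form \<sigma> \<phi>"

primrec fvs :: "'p form \<Rightarrow> nat set" where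
  "fvs Bot = {}"
| "fvs (Eq x y) = {x, y}"
| "fvs (Rel P xs) = set xs"
| "fvs (Neg \<phi>) = fvs \<phi>"
| "fvs (Conj \<phi> \<psi>) = fvs \<phi> \<union> fvs \<psi>"
| "fvs (Ex x \<phi>) = fvs \<phi> - {x}"
| "fvs (TC x y \<phi> u v) = (fvs \<phi> - {x, y}) \<union> {u, v}"

primrec qdepth :: "'p form \<Rightarrow> nat" where
  "qdepth Bot = 0"
| "qdepth (Eq x y) = 0"
| "qdepth (Rel P xs) = 0"
| "qdepth (Neg \<phi>) = qdepth \<phi>"
| "qdepth (Conj \<phi> \<psi>) = max (qdepth \<phi>) (qdepth \<psi>)"
| "qdepth (Ex x \<phi>) = Suc (qdepth \<phi>)"
| "qdepth (TC x y \<phi> u v) = Suc (qdepth \<phi>)"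

primrec quantifier_free_fo :: "'p form \<Rightarrow> bool" where
  "quantifier_free_fo Bot \<longleftrightarrow> True"
| "quantifier_free_fo (Eq x y) \<longleftrightarrow> True"
| "quantifier_free_fo (Rel P xs) \<longleftrightarrow> True"
| "quantifier_free_fo (Neg \<phi>) \<longleftrightarrow> quantifier_free_fo \<phi>"
| "quantifier_free_fo (Conj \<phi> \<psi>) \<longleftrightarrow> quantifier_free_fo \<phi> \<and> quantifier_free_fo \<psi>"
| "quantifier_free_fo (Ex x \<phi>) \<longleftrightarrow> False"
| "quantifier_free_fo (TC x y \<phi> u v) \<longleftrightarrow> False"

record ('p, 'a) frame =
  universe :: "'a set"
  interp :: "'p \<Rightarrow> 'a list set"
  admissible :: "'a set set"

definition is_frame :: "'p signature \<Rightarrow> ('p, 'a) frame \<Rightarrow> bool" where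
  "is_frame \<sigma> M \<longleftrightarrow>
     universe M \<noteq> {} \<and>
     (\<forall>P n. \<sigma> P = Some n \<longrightarrow> interp M P \<subseteq> {ts. length ts = n \<and> set ts \<subseteq> universe M}) \<and>
     admissible M \<subseteq> Pow (universe M)"

primrec sat :: "('p, 'a) frame \<Rightarrow> (nat \<Rightarrow> 'a) \<Rightarrow> 'p form \<Rightarrow> bool" where
  "sat M g Bot \<longleftrightarrow> False"
| "sat M g (Eq x y) \<longleftrightarrow> g x = g y"
| "sat M g (Rel P xs) \<longleftrightarrow> map g xs \<in> interp M P"
| "sat M g (Neg \<phi>) \<longleftrightarrow> \<not> sat M g \<phi>"
| "sat M g (Conj \<phi> \<psi>) \<longleftrightarrow> sat M g \<phi> \<and> sat M g \<psi>"
| "sat M g (Ex x \<phi>) \<longleftrightarrow> (\<exists>a\<in>universe M. sat M (g(x := a)) \<phi>)"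
| "sat M g (TC x y \<phi> u v) \<longleftrightarrow>
     (\<forall>A\<in>admissible M.
        g u \<in> A \<and>
        (\<forall>a\<in>universe M. \<forall>b\<in>universe M. a \<in> A \<and> sat M (g(x := a, y := b)) \<phi> \<longrightarrow> b \<in> A)
        \<longrightarrow> g v \<in> A)"

definition henkin_structure :: "'p signature \<Rightarrow> ('p, 'a) frame \<Rightarrow> bool" where
  "henkin_structure \<sigma> M \<longleftrightarrow>
     is_frame \<sigma> M \<and>
     (\<forall>\<phi> g x. wf_form \<sigma> \<phi> \<and> range g \<subseteq> universe M \<longrightarrow>
        {a \<in> universe M. sat M (g(x := a)) \<phi>} \<in> admissible M)"

text \<open>
  In a parametrized structure \<open>(M, as)\<close> the parameter \<open>as ! j\<close> is the value of the variable \<open>j\<close>;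
  only formulas whose free variables all name parameters are compared, so the assignment
  outside \<open>{..<length as}\<close> is irrelevant.
\<close>

definition tc_equiv ::
  "'p signature \<Rightarrow> nat \<Rightarrow> ('p, 'a) frame \<times> 'a list \<Rightarrow> ('p, 'b) frame \<times> 'b list \<Rightarrow> bool" where
  "tc_equiv \<sigma> n = (\<lambda>(M, as) (N, bs).
     length as = length bs \<and>
     (\<forall>\<phi>. wf_form \<sigma> \<phi> \<and> qdepth \<phi> \<le> n \<and> fvs \<phi> \<subseteq> {..<length as} \<longrightarrow>
        (sat M (\<lambda>j. as ! j) \<phi> \<longleftrightarrow> sat N (\<lambda>j. bs ! j) \<phi>)))"

text \<open>\<open>\<sigma>\<^sup>*\<close>: \<open>Inl P\<close> is the old symbol \<open>P\<close>, and \<open>Inr i\<close> for \<open>1 \<le> i \<le> k\<close> is the unary symbol \<open>Q\<^sub>i\<close>.\<close>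

definition sig_star :: "'p signature \<Rightarrow> nat \<Rightarrow> ('p + nat) signature" where
  "sig_star \<sigma> k = case_sum \<sigma> (\<lambda>i. if i \<in> {1..k} then Some 1 else None)"

definition disjoint_sum :: "nat \<Rightarrow> (nat \<Rightarrow> ('p, 'a) frame) \<Rightarrow> ('p + nat, 'a) frame" where
  "disjoint_sum k M =
     \<lparr>universe = (\<Union>i\<in>{1..k}. universe (M i)),
      interp = case_sum (\<lambda>P. \<Union>i\<in>{1..k}. interp (M i) P) (\<lambda>i. {[a] | a. a \<in> universe (M i)}),
      admissible = {(\<Union>i\<in>{1..k}. A i) | A. \<forall>i\<in>{1..k}. A i \<in> admissible (M i)}\<rparr>"

text \<open>The variables \<open>x\<^sub>1, \<dots>, x\<^sub>n\<close> of \<open>f P\<close> are numbered \<open>0, \<dots>, n - 1\<close>.\<close>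

definition fusion_map :: "'p signature \<Rightarrow> nat \<Rightarrow> ('p \<Rightarrow> ('p + nat) form) \<Rightarrow> bool" where
  "fusion_map \<sigma> k f \<longleftrightarrow>
     (\<forall>P n. \<sigma> P = Some n \<longrightarrow>
        wf_form (sig_star \<sigma> k) (f P) \<and> quantifier_free_fo (f P) \<and> fvs (f P) \<subseteq> {..<n})"

definition fusion ::
  "'p signature \<Rightarrow> ('p \<Rightarrow> ('p + nat) form) \<Rightarrow> nat \<Rightarrow> (nat \<Rightarrow> ('p, 'a) frame) \<Rightarrow> ('p, 'a) frame" where
  "fusion \<sigma> f k M =
     \<lparr>universe = universe (disjoint_sum k M),
      interp = (\<lambda>P. {ts. \<sigma> P = Some (length ts) \<and> set ts \<subseteq> universe (disjoint_sum k M) \<and>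
                         sat (disjoint_sum k M) (\<lambda>j. ts ! j) (f P)}),
      admissible = admissible (disjoint_sum k M)\<rparr>"

end

theory Submission
  imports Defs
begin

text \<open>
  An Ehrenfeucht-Fraisse argument. A formula mentions only finitely many symbols, so finitely many
  formulas of depth \<open>n\<close> describe the type of a tuple. To transfer a \<open>TC\<close> formula, an admissible set
  \<open>\<Union>\<^sub>i B\<^sub>i\<close> of the fusion of the \<open>N\<^sub>i\<close> is answered componentwise: \<open>A\<^sub>i\<close> has to contain the same
  parameters as \<open>B\<^sub>i\<close>, and elements inside and outside \<open>A\<^sub>i\<close>, and pairs of one inside and one outside,
  must have \<open>n\<close>-types that occur likewise around \<open>B\<^sub>i\<close>. Call a pair a step if its type does not occur
  as one leaving \<open>B\<^sub>i\<close>. The elements reached by steps from the parameters in \<open>B\<^sub>i\<close> form a definable,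
  hence admissible, set \<open>A\<^sub>i\<close>, and \<open>TC\<close> formulas of depth \<open>n + 1\<close> transfer its relation to the
  parameters from \<open>N\<^sub>i\<close> to \<open>M\<^sub>i\<close>. If all parameters lie on one side of \<open>B\<^sub>i\<close>, one of two distinct
  parameters serves as a target signalling that an element of a forbidden type has been reached.
\<close>

section \<open>Satisfaction and Boolean combinations of finitely many formulas\<close>

lemma sat_cong:
  "(\<And>x. x \<in> fvs \<phi> \<Longrightarrow> g x = h x) \<Longrightarrow> sat M g \<phi> \<longleftrightarrow> sat M h \<phi>"
proof (induction \<phi> arbitrary: g h)
  case (Neg \<phi>)
  show ?case using Neg.IH[of g h] Neg.prems by simp
next
  case (Rel P xs)
  then have "map g xs = map h xs" by simp
  then show ?case by (simp only: sat.simps)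
next
  case (Conj \<phi> \<psi>)
  have "sat M g \<phi> = sat M h \<phi>" "sat M g \<psi> = sat M h \<psi>"
    using Conj.IH(1)[of g h] Conj.IH(2)[of g h] Conj.prems by simp_all
  then show ?case by simp
next
  case (Ex x \<phi>)
  have "sat M (g(x := a)) \<phi> = sat M (h(x := a)) \<phi>" for a
    using Ex.prems by (intro Ex.IH) auto
  then show ?case by simp
next
  case (TC x y \<phi> u v)
  have "sat M (g(x := a, y := b)) \<phi> = sat M (h(x := a, y := b)) \<phi>" for a b
    using TC.prems by (intro TC.IH) auto
  moreover have "g u = h u" "g v = h v" using TC.prems by auto
  ultimately show ?case by simp
qed simp_all

abbreviation Disj :: "'p form \<Rightarrow> 'p form \<Rightarrow> 'p form" where
  "Disj \<phi> \<psi> \<equiv> Neg (Conj (Neg \<phi>) (Neg \<psi>))"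

text \<open>
  \<open>select F Q\<close> says that the list of truth values of the formulas in \<open>F\<close> satisfies \<open>Q\<close>;
  although there may be infinitely many \<open>Q\<close>, the list \<open>selections F\<close> exhausts these formulas.
\<close>

primrec select :: "'p form list \<Rightarrow> (bool list \<Rightarrow> bool) \<Rightarrow> 'p form" where
  "select [] Q = (if Q [] then Neg Bot else Bot)"
| "select (\<phi> # F) Q =
     Disj (Conj \<phi> (select F (\<lambda>t. Q (True # t)))) (Conj (Neg \<phi>) (select F (\<lambda>t. Q (False # t))))"

primrec selections :: "'p form list \<Rightarrow> 'p form list" where
  "selections [] = [Bot, Neg Bot]"
| "selections (\<phi> # F) =
     [Disj (Conj \<phi> \<alpha>) (Conj (Neg \<phi>) \<beta>). \<alpha> \<leftarrow> selections F, \<beta> \<leftarrow> selections F]"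

lemma sat_select: "sat M g (select F Q) \<longleftrightarrow> Q (map (sat M g) F)"
proof (induction F arbitrary: Q)
  case (Cons \<phi> F)
  then show ?case by (cases "sat M g \<phi>") simp_all
qed simp

lemma select_in_selections: "select F Q \<in> set (selections F)"
proof (induction F arbitrary: Q)
  case (Cons \<phi> F)
  have "Disj (Conj \<phi> \<alpha>) (Conj (Neg \<phi>) \<beta>) \<in> set (selections (\<phi> # F))"
    if "\<alpha> \<in> set (selections F)" "\<beta> \<in> set (selections F)" for \<alpha> \<beta>
    using that by auto
  from this[OF Cons Cons] show ?case by (simp only: select.simps)
qed simp

text \<open>Boolean combinations raise neither the depth nor the set of free variables, so types
  cost no more depth than the formulas they are built from.\<close>

lemma selections_bounds:
  assumes "\<phi> \<in> set (selections F)"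
    and "\<And>\<psi>. \<psi> \<in> set F \<Longrightarrow> wf_form \<sigma> \<psi> \<and> qdepth \<psi> \<le> n \<and> fvs \<psi> \<subseteq> V"
  shows "wf_form \<sigma> \<phi> \<and> qdepth \<phi> \<le> n \<and> fvs \<phi> \<subseteq> V"
  using assms
proof (induction F arbitrary: \<phi>)
  case (Cons \<psi> F)
  then obtain \<alpha> \<beta> where "\<phi> = Disj (Conj \<psi> \<alpha>) (Conj (Neg \<psi>) \<beta>)"
    and "\<alpha> \<in> set (selections F)" "\<beta> \<in> set (selections F)"
    by auto
  moreover have "wf_form \<sigma> \<psi> \<and> qdepth \<psi> \<le> n \<and> fvs \<psi> \<subseteq> V" using Cons.prems by simp
  ultimately show ?case using Cons.IH[of \<alpha>] Cons.IH[of \<beta>] Cons.prems by simp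
qed auto

text \<open>
  A step of \<open>\<psi>\<close> not ending in the parameter \<open>d\<close>, or a step to \<open>d\<close> from an element satisfying \<open>\<tau>\<close>:
  the transitive closure of this relation reaches \<open>d\<close> exactly if a \<open>\<tau>\<close>-element is reached, which
  saves the quantifier that would express the latter directly.
\<close>

definition escape :: "nat \<Rightarrow> nat \<Rightarrow> 'p form \<Rightarrow> 'p form \<Rightarrow> 'p form" where
  "escape y d \<psi> \<tau> = Disj (Conj (Neg (Eq y d)) \<psi>) (Conj (Eq y d) \<tau>)"

text \<open>Beyond the parameters the value is an arbitrary element of the universe. This makes it
  an assignment to which the comprehension condition of \<open>henkin_structure\<close>
  applies.\<close>

definition val :: "('p, 'a) frame \<Rightarrow> 'a list \<Rightarrow> nat \<Rightarrow> 'a" where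
  "val M as j = (if j < length as then as ! j else (SOME a. a \<in> universe M))"

lemma val_range: "universe M \<noteq> {} \<Longrightarrow> set as \<subseteq> universe M \<Longrightarrow> val M as j \<in> universe M"
  by (auto simp: val_def some_in_eq dest: nth_mem)

section \<open>Reachability in the Henkin sense and definable sets\<close>

definition closed_under :: "('p, 'a) frame \<Rightarrow> ('a \<Rightarrow> 'a \<Rightarrow> bool) \<Rightarrow> 'a set \<Rightarrow> bool" where
  "closed_under M R A \<longleftrightarrow> (\<forall>a\<in>universe M. \<forall>b\<in>universe M. a \<in> A \<and> R a b \<longrightarrow> b \<in> A)"

text \<open>The Henkin counterpart of the reflexive transitive closure. It takes a relation instead
  of a formula, so that it covers converse steps and formulas evaluated in a fusion.\<close>

definition reach :: "('p, 'a) frame \<Rightarrow> ('a \<Rightarrow> 'a \<Rightarrow> bool) \<Rightarrow> 'a \<Rightarrow> 'a set" where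
  "reach M R p = {b \<in> universe M. \<forall>A\<in>admissible M. p \<in> A \<and> closed_under M R A \<longrightarrow> b \<in> A}"

definition step :: "('p, 'a) frame \<Rightarrow> 'a list \<Rightarrow> 'p form \<Rightarrow> 'a \<Rightarrow> 'a \<Rightarrow> bool" where
  "step M as \<psi> x y \<longleftrightarrow> sat M ((val M as)(length as := x, Suc (length as) := y)) \<psi>"

lemma closed_underD:
  "closed_under M R A \<Longrightarrow> a \<in> universe M \<Longrightarrow> b \<in> universe M \<Longrightarrow> a \<in> A \<Longrightarrow> R a b \<Longrightarrow> b \<in> A"
  unfolding closed_under_def by blast

lemma closed_under_Union:
  "(\<And>i. i \<in> I \<Longrightarrow> closed_under M R (A i)) \<Longrightarrow> closed_under M R (\<Union>i\<in>I. A i)"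
  unfolding closed_under_def by blast

text \<open>An intersection of closed sets is closed, whether or not it is admissible.\<close>

lemma closed_under_reach: "closed_under M R (reach M R p)"
  unfolding closed_under_def reach_def by blast

lemma reach_self: "p \<in> universe M \<Longrightarrow> p \<in> reach M R p"
  unfolding reach_def by blast

lemma reach_subset: "A \<in> admissible M \<Longrightarrow> p \<in> A \<Longrightarrow> closed_under M R A \<Longrightarrow> reach M R p \<subseteq> A"
  unfolding reach_def by blast

lemma sat_TC_reach:
  assumes "u < length as" "v < length as" "set as \<subseteq> universe M"
  shows "sat M (val M as) (TC (length as) (Suc (length as)) \<psi> u v) \<longleftrightarrow>
    as ! v \<in> reach M (step M as \<psi>) (as ! u)"
  using assms by (auto simp: val_def reach_def closed_under_def step_def subset_iff)

lemma step_escape: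
  assumes "d < length as"
  shows "step M as (escape (Suc (length as)) d \<psi> \<tau>) x y \<longleftrightarrow>
    (y \<noteq> as ! d \<and> step M as \<psi> x y) \<or> (y = as ! d \<and> step M as \<tau> x y)"
  using assms by (auto simp: step_def escape_def val_def)

text \<open>
  All formulas defining sets use the same assignment and the same variable, so that
  definable sets form a Boolean algebra without renaming variables.
\<close>

definition definable :: "'p signature \<Rightarrow> ('p, 'a) frame \<Rightarrow> 'a list \<Rightarrow> 'a set \<Rightarrow> bool" where
  "definable \<sigma> M as X \<longleftrightarrow> (\<exists>\<phi>. wf_form \<sigma> \<phi> \<and>
     X = {a \<in> universe M. sat M ((val M as)(length as + 2 := a)) \<phi>})"

lemma definable_compl: "definable \<sigma> M as X \<Longrightarrow> definable \<sigma> M as (universe M - X)"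
  unfolding definable_def
proof (elim exE conjE)
  fix \<phi> assume "wf_form \<sigma> \<phi>" "X = {a \<in> universe M. sat M ((val M as)(length as + 2 := a)) \<phi>}"
  then show "\<exists>\<phi>. wf_form \<sigma> \<phi> \<and> universe M - X =
      {a \<in> universe M. sat M ((val M as)(length as + 2 := a)) \<phi>}"
    by (intro exI[of _ "Neg \<phi>"]) auto
qed

lemma definable_Int:
  assumes "definable \<sigma> M as X" "definable \<sigma> M as Y"
  shows "definable \<sigma> M as (X \<inter> Y)"
proof -
  obtain \<phi> where \<phi>: "wf_form \<sigma> \<phi>"
    "X = {a \<in> universe M. sat M ((val M as)(length as + 2 := a)) \<phi>}"
    using assms(1) unfolding definable_def by (elim exE conjE) (rule that)
  obtain \<psi> where \<psi>: "wf_form \<sigma> \<psi>"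
    "Y = {a \<in> universe M. sat M ((val M as)(length as + 2 := a)) \<psi>}"
    using assms(2) unfolding definable_def by (elim exE conjE) (rule that)
  show ?thesis
    unfolding definable_def using \<phi> \<psi> by (intro exI[of _ "Conj \<phi> \<psi>"]) auto
qed

lemma definable_subset: "definable \<sigma> M as X \<Longrightarrow> X \<subseteq> universe M"
  unfolding definable_def by auto

lemma definable_empty: "definable \<sigma> M as {}"
  unfolding definable_def by (intro exI[of _ Bot]) auto

lemma definable_Un:
  assumes "definable \<sigma> M as X" "definable \<sigma> M as Y"
  shows "definable \<sigma> M as (X \<union> Y)"
proof -
  have "X \<union> Y = universe M - ((universe M - X) \<inter> (universe M - Y))"
    using definable_subset[OF assms(1)] definable_subset[OF assms(2)] by blast
  then show ?thesis
    using definable_compl[OF definable_Int[OF definable_compl[OF assms(1)] definable_compl[OF assms(2)]]]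
    by (simp only:)
qed

lemma definable_Union:
  "finite I \<Longrightarrow> (\<And>i. i \<in> I \<Longrightarrow> definable \<sigma> M as (A i)) \<Longrightarrow> definable \<sigma> M as (\<Union>i\<in>I. A i)"
  by (induction I rule: finite_induct) (auto intro: definable_empty definable_Un)

lemma definable_remove:
  assumes "definable \<sigma> M as X" "d < length as"
  shows "definable \<sigma> M as (X - {as ! d})"
proof -
  have "definable \<sigma> M as {a \<in> universe M. a \<noteq> as ! d}"
    unfolding definable_def using assms(2)
    by (intro exI[of _ "Neg (Eq (length as + 2) d)"]) (auto simp: val_def)
  moreover have "X - {as ! d} = X \<inter> {a \<in> universe M. a \<noteq> as ! d}"
    using definable_subset[OF assms(1)] by blast
  ultimately show ?thesis using definable_Int[OF assms(1)] by (simp only:)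
qed

lemma definable_admissible:
  assumes "henkin_structure \<sigma> M" "set as \<subseteq> universe M" "definable \<sigma> M as X"
  shows "X \<in> admissible M"
proof -
  have "universe M \<noteq> {}" using assms(1) by (auto simp: henkin_structure_def is_frame_def)
  then have "range (val M as) \<subseteq> universe M" using val_range[OF _ assms(2)] by auto
  moreover obtain \<phi> where "wf_form \<sigma> \<phi>"
    "X = {a \<in> universe M. sat M ((val M as)(length as + 2 := a)) \<phi>}"
    using assms(3) unfolding definable_def by (elim exE conjE) (rule that)
  ultimately show ?thesis using assms(1) unfolding henkin_structure_def by simp
qed

text \<open>The variables \<open>length as\<close> and \<open>Suc (length as)\<close> are those
  bound by \<open>TC\<close>; the defining variable \<open>length as + 2\<close> lies beyond them
  and does not affect steps.\<close>

lemma step_fresh: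
  assumes "fvs \<psi> \<subseteq> {..<length as + 2}"
  shows "sat M ((val M as)(length as + 2 := b, length as := x, Suc (length as) := y)) \<psi> \<longleftrightarrow>
    step M as \<psi> x y"
  unfolding step_def using assms by (intro sat_cong) auto

lemma definable_reach:
  assumes "wf_form \<sigma> \<psi>" "fvs \<psi> \<subseteq> {..<length as + 2}" "p < length as"
  shows "definable \<sigma> M as (reach M (step M as \<psi>) (as ! p))"
proof -
  let ?m = "length as"
  have "sat M ((val M as)(?m + 2 := c)) (TC ?m (Suc ?m) \<psi> p (?m + 2)) \<longleftrightarrow>
      (\<forall>A\<in>admissible M. as ! p \<in> A \<and> closed_under M (step M as \<psi>) A \<longrightarrow> c \<in> A)" for c
    using assms(3) by (simp only: sat.simps step_fresh[OF assms(2)]) (simp add: val_def closed_under_def)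
  then show ?thesis
    unfolding definable_def reach_def using assms(1)
    by (intro exI[of _ "TC ?m (Suc ?m) \<psi> p (?m + 2)"]) simp
qed

text \<open>Exchanging the two bound variables of \<open>TC\<close> yields converse steps. This
  serves where only the complement of a set is known to be admissible.\<close>

lemma definable_coreach:
  assumes "wf_form \<sigma> \<psi>" "fvs \<psi> \<subseteq> {..<length as + 2}" "p < length as" "set as \<subseteq> universe M"
  shows "definable \<sigma> M as {b \<in> universe M. as ! p \<in> reach M (\<lambda>x y. step M as \<psi> y x) b}"
proof -
  let ?m = "length as"
  have swap: "(val M as)(?m + 2 := c, Suc ?m := a, ?m := b) =
      (val M as)(?m + 2 := c, ?m := b, Suc ?m := a)" for a b c
    by (rule fun_upd_twist) simp
  have "as ! p \<in> universe M" using assms(3,4) by auto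
  moreover have "sat M ((val M as)(?m + 2 := c)) (TC (Suc ?m) ?m \<psi> (?m + 2) p) \<longleftrightarrow>
      (\<forall>A\<in>admissible M. c \<in> A \<and> closed_under M (\<lambda>x y. step M as \<psi> y x) A \<longrightarrow> as ! p \<in> A)" for c
    using assms(3)
    by (simp only: sat.simps swap step_fresh[OF assms(2)]) (simp add: val_def closed_under_def)
  ultimately show ?thesis
    unfolding definable_def reach_def using assms(1)
    by (intro exI[of _ "TC (Suc ?m) ?m \<psi> (?m + 2) p"]) simp
qed

text \<open>Admissible sets need not be closed under complement, so \<open>C\<close> itself may fail
  to be admissible. If \<open>C = B\<close>, forward reachability from the parameters stays inside
  \<open>B\<close>. If \<open>C\<close> is the complement, \<open>B\<close> is closed under converse
  steps, so no element of \<open>B\<close> reaches a parameter by converse steps, and the elements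
  that do form \<open>D\<close>.\<close>

lemma definable_closure:
  assumes as: "set as \<subseteq> universe M"
    and B: "B \<in> admissible M" "B \<subseteq> universe M"
    and C: "C = B \<or> C = universe M - B" "set as \<subseteq> C"
    and \<psi>: "wf_form \<sigma> \<psi>" "fvs \<psi> \<subseteq> {..<length as + 2}"
    and closed: "closed_under M (step M as \<psi>) C"
  shows "\<exists>D. definable \<sigma> M as D \<and> set as \<subseteq> D \<and> D \<subseteq> C \<and> closed_under M (step M as \<psi>) D"
  using C(1)
proof
  assume C_eq: "C = B"
  let ?D = "\<Union>p<length as. reach M (step M as \<psi>) (as ! p)"
  have "definable \<sigma> M as ?D" by (intro definable_Union definable_reach \<psi>) auto
  moreover have "set as \<subseteq> ?D"
  proof
    fix a assume "a \<in> set as"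
    then obtain p where "p < length as" "a = as ! p" by (auto simp: in_set_conv_nth)
    moreover from this have "as ! p \<in> reach M (step M as \<psi>) (as ! p)"
      using as by (intro reach_self) auto
    ultimately show "a \<in> ?D" by blast
  qed
  moreover have "?D \<subseteq> C"
  proof (intro UN_least reach_subset)
    show "closed_under M (step M as \<psi>) C" "C \<in> admissible M" using closed B(1) C_eq by auto
    show "as ! p \<in> C" if "p \<in> {..<length as}" for p using C(2) that by auto
  qed
  moreover have "closed_under M (step M as \<psi>) ?D"
    by (intro closed_under_Union closed_under_reach)
  ultimately show ?thesis by blast
next
  assume C_eq: "C = universe M - B"
  let ?R = "\<lambda>x y. step M as \<psi> y x"
  let ?E = "\<lambda>p. {b \<in> universe M. as ! p \<in> reach M ?R b}"
  let ?D = "\<Union>p<length as. ?E p"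
  have "definable \<sigma> M as ?D" by (intro definable_Union definable_coreach \<psi> as) auto
  moreover have "set as \<subseteq> ?D"
  proof
    fix a assume "a \<in> set as"
    then obtain p where "p < length as" "a = as ! p" by (auto simp: in_set_conv_nth)
    moreover from this have "as ! p \<in> reach M ?R (as ! p)" "as ! p \<in> universe M"
      using as by (auto intro!: reach_self)
    ultimately show "a \<in> ?D" by blast
  qed
  moreover have "?D \<subseteq> C"
  proof
    fix b assume "b \<in> ?D"
    then obtain p where p: "p < length as" "b \<in> universe M" "as ! p \<in> reach M ?R b" by blast
    have "closed_under M ?R B" using closed C_eq unfolding closed_under_def by blast
    then have "b \<in> B \<Longrightarrow> as ! p \<in> B" using p reach_subset[OF B(1)] by blast
    moreover have "as ! p \<notin> B" using C(2) C_eq p(1) by (auto simp: subset_iff)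
    ultimately show "b \<in> C" using C_eq p(2) by blast
  qed
  \<comment> \<open>If a step leads from \<open>x\<close> to \<open>y\<close>, every set that
    contains \<open>y\<close> and is closed under converse steps contains \<open>x\<close>, hence
    also the parameter.\<close>
  moreover have "closed_under M (step M as \<psi>) (?E p)" for p
    unfolding closed_under_def reach_def by blast
  then have "closed_under M (step M as \<psi>) ?D" by (intro closed_under_Union)
  ultimately show ?thesis by blast
qed

subsection \<open>Types of bounded depth over a finite signature\<close>

definition atoms :: "'p signature \<Rightarrow> 'p list \<Rightarrow> nat \<Rightarrow> 'p form list" where
  "atoms \<sigma> ps m = [Eq i j. i \<leftarrow> [0..<m], j \<leftarrow> [0..<m]] @
     [Rel P xs. P \<leftarrow> filter (\<lambda>P. \<sigma> P \<noteq> None) ps, xs \<leftarrow> List.n_lists (the (\<sigma> P)) [0..<m]]"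

context
  fixes \<sigma> :: "'p signature" and ps :: "'p list"
begin

text \<open>Level \<open>Suc n\<close> contains what the matching lemmas transfer: \<open>Ex\<close>
  for single elements, plain \<open>TC\<close> for parameters on both sides of a set,
  \<open>escape\<close> for parameters on one side. Bodies range over all selections of the level
  below, finitely many because \<open>ps\<close> is a list. In the last group the endpoint
  \<open>v\<close> doubles as the target parameter.\<close>

primrec basis :: "nat \<Rightarrow> nat \<Rightarrow> 'p form list" where
  "basis 0 m = atoms \<sigma> ps m"
| "basis (Suc n) m = basis n m @
     map (Ex m) (selections (basis n (m + 1))) @
     [TC m (Suc m) \<psi> u v. \<psi> \<leftarrow> selections (basis n (m + 2)), u \<leftarrow> [0..<m], v \<leftarrow> [0..<m]] @
     [TC m (Suc m) (escape (Suc m) v \<psi> \<tau>) u v.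
        \<psi> \<leftarrow> selections (basis n (m + 2)), \<tau> \<leftarrow> selections (basis n (m + 1)),
        u \<leftarrow> [0..<m], v \<leftarrow> [0..<m]]"

lemma atoms_iff:
  "\<phi> \<in> set (atoms \<sigma> ps m) \<longleftrightarrow>
     (\<exists>i\<in>{..<m}. \<exists>j\<in>{..<m}. \<phi> = Eq i j) \<or>
     (\<exists>P\<in>set ps. \<exists>xs. \<sigma> P = Some (length xs) \<and> set xs \<subseteq> {..<m} \<and> \<phi> = Rel P xs)"
proof -
  have "\<phi> \<in> set (atoms \<sigma> ps m) \<longleftrightarrow> (\<exists>i\<in>{..<m}. \<exists>j\<in>{..<m}. \<phi> = Eq i j) \<or>
      (\<exists>P\<in>{P\<in>set ps. \<sigma> P \<noteq> None}.
        \<exists>xs\<in>{xs. length xs = the (\<sigma> P) \<and> set xs \<subseteq> {..<m}}. \<phi> = Rel P xs)"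
    by (simp add: atoms_def set_n_lists image_iff atLeast0LessThan)
  also have "\<dots> \<longleftrightarrow> (\<exists>i\<in>{..<m}. \<exists>j\<in>{..<m}. \<phi> = Eq i j) \<or>
      (\<exists>P\<in>set ps. \<exists>xs. \<sigma> P = Some (length xs) \<and> set xs \<subseteq> {..<m} \<and> \<phi> = Rel P xs)"
    by force
  finally show ?thesis .
qed

lemma basis_Suc_iff:
  "\<phi> \<in> set (basis (Suc n) m) \<longleftrightarrow> \<phi> \<in> set (basis n m) \<or>
     (\<exists>\<psi>\<in>set (selections (basis n (m + 1))). \<phi> = Ex m \<psi>) \<or>
     (\<exists>\<psi>\<in>set (selections (basis n (m + 2))). \<exists>u\<in>{..<m}. \<exists>v\<in>{..<m}. \<phi> = TC m (Suc m) \<psi> u v) \<or>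
     (\<exists>\<psi>\<in>set (selections (basis n (m + 2))). \<exists>\<tau>\<in>set (selections (basis n (m + 1))).
        \<exists>u\<in>{..<m}. \<exists>v\<in>{..<m}. \<phi> = TC m (Suc m) (escape (Suc m) v \<psi> \<tau>) u v)"
  by (simp add: image_iff atLeast0LessThan)

lemma basis_bounds:
  "\<phi> \<in> set (basis n m) \<Longrightarrow> wf_form \<sigma> \<phi> \<and> qdepth \<phi> \<le> n \<and> fvs \<phi> \<subseteq> {..<m}"
proof (induction n arbitrary: \<phi> m)
  case 0
  then show ?case by (auto simp: atoms_iff)
next
  case (Suc n)
  have sel: "wf_form \<sigma> \<psi> \<and> qdepth \<psi> \<le> n \<and> fvs \<psi> \<subseteq> {..<l}"
    if "\<psi> \<in> set (selections (basis n l))" for \<psi> l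
    using selections_bounds[OF that] Suc.IH by blast
  consider "\<phi> \<in> set (basis n m)"
    | \<psi> where "\<phi> = Ex m \<psi>" "\<psi> \<in> set (selections (basis n (m + 1)))"
    | \<psi> u v where "\<phi> = TC m (Suc m) \<psi> u v" "u < m" "v < m" "\<psi> \<in> set (selections (basis n (m + 2)))"
    | \<psi> \<tau> u v where "\<phi> = TC m (Suc m) (escape (Suc m) v \<psi> \<tau>) u v" "u < m" "v < m"
      "\<psi> \<in> set (selections (basis n (m + 2)))" "\<tau> \<in> set (selections (basis n (m + 1)))"
    using Suc.prems unfolding basis_Suc_iff by blast
  then show ?case
  proof cases
    case 1
    then show ?thesis using Suc.IH by fastforce
  next
    case 2
    then show ?thesis using sel[of \<psi> "m + 1"] by (auto simp: less_Suc_eq)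
  next
    case 3
    then show ?thesis using sel[of \<psi> "m + 2"] by (auto simp: less_Suc_eq)
  next
    case 4
    then show ?thesis using sel[of \<psi> "m + 2"] sel[of \<tau> "m + 1"]
      by (auto simp: escape_def less_Suc_eq)
  qed
qed

lemma atoms_subset_basis: "set (atoms \<sigma> ps m) \<subseteq> set (basis n m)"
  by (induction n) auto

text \<open>Truth values instead of formulas, so that types can be collected in sets and compared
  across structures with different carriers.\<close>

definition tp :: "nat \<Rightarrow> ('p, 'a) frame \<Rightarrow> 'a list \<Rightarrow> bool list" where
  "tp n M as = map (sat M (val M as)) (basis n (length as))"

definition same_type :: "nat \<Rightarrow> ('p, 'a) frame \<Rightarrow> 'a list \<Rightarrow> ('p, 'b) frame \<Rightarrow> 'b list \<Rightarrow> bool" where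
  "same_type n M as N bs \<longleftrightarrow> length as = length bs \<and> tp n M as = tp n N bs"

lemma same_type_sym: "same_type n M as N bs \<Longrightarrow> same_type n N bs M as"
  by (simp add: same_type_def)

lemma same_typeD:
  "same_type n M as N bs \<Longrightarrow> \<phi> \<in> set (basis n (length as)) \<Longrightarrow>
    sat M (val M as) \<phi> \<longleftrightarrow> sat N (val N bs) \<phi>"
  by (auto simp: same_type_def tp_def)

lemma same_type_Suc: "same_type (Suc n) M as N bs \<Longrightarrow> same_type n M as N bs"
  by (auto simp: same_type_def tp_def)

lemma same_type_eq_iff:
  assumes "same_type n M as N bs" "i < length as" "j < length as"
  shows "as ! i = as ! j \<longleftrightarrow> bs ! i = bs ! j"
proof -
  have "Eq i j \<in> set (basis n (length as))"
    using assms(2,3) by (intro subsetD[OF atoms_subset_basis]) (simp add: atoms_iff)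
  from same_typeD[OF assms(1) this] show ?thesis
    using assms by (simp add: val_def same_type_def)
qed

lemma same_type_Rel:
  assumes "same_type n M as N bs" "R \<in> set ps" "\<sigma> R = Some (length xs)" "set xs \<subseteq> {..<length as}"
  shows "map ((!) as) xs \<in> interp M R \<longleftrightarrow> map ((!) bs) xs \<in> interp N R"
proof -
  have in_basis: "Rel R xs \<in> set (basis n (length as))"
    using assms(2-4) by (intro subsetD[OF atoms_subset_basis]) (simp add: atoms_iff)
  have "map (val M as) xs = map ((!) as) xs" "map (val N bs) xs = map ((!) bs) xs"
    using assms(1,4) by (auto simp: val_def same_type_def subset_iff)
  then show ?thesis using same_typeD[OF assms(1) in_basis] by (simp only: sat.simps)
qed

text \<open>Every set of types of pairs is expressed by one selection, so steps may be prescribed by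
  types.\<close>

lemma step_select2:
  "step M as (select (basis n (length as + 2)) Q) x y \<longleftrightarrow> Q (tp n M (as @ [x, y]))"
proof -
  have "sat M ((val M as)(length as := x, Suc (length as) := y)) \<phi> = sat M (val M (as @ [x, y])) \<phi>"
    if "\<phi> \<in> set (basis n (length as + 2))" for \<phi>
    using basis_bounds[OF that]
    by (intro sat_cong) (auto simp: val_def nth_append subset_iff less_Suc_eq)
  then have "map (sat M ((val M as)(length as := x, Suc (length as) := y))) (basis n (length as + 2))
      = tp n M (as @ [x, y])"
    unfolding tp_def by (auto intro!: map_cong)
  then show ?thesis by (simp only: step_def sat_select)
qed

lemma sat_select1:
  "sat M ((val M as)(length as := x)) (select (basis n (length as + 1)) Q) \<longleftrightarrow> Q (tp n M (as @ [x]))"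
proof -
  have "sat M ((val M as)(length as := x)) \<phi> = sat M (val M (as @ [x])) \<phi>"
    if "\<phi> \<in> set (basis n (length as + 1))" for \<phi>
    using basis_bounds[OF that]
    by (intro sat_cong) (auto simp: val_def nth_append subset_iff less_Suc_eq)
  then have "map (sat M ((val M as)(length as := x))) (basis n (length as + 1)) = tp n M (as @ [x])"
    unfolding tp_def by (auto intro!: map_cong)
  then show ?thesis by (simp only: sat_select)
qed

lemma step_select1:
  "step M as (select (basis n (length as + 1)) Q) x y \<longleftrightarrow> Q (tp n M (as @ [x]))"
proof -
  let ?\<tau> = "select (basis n (length as + 1)) Q"
  have "fvs ?\<tau> \<subseteq> {..<length as + 1}"
    using selections_bounds[OF select_in_selections] basis_bounds by blast
  then have "step M as ?\<tau> x y \<longleftrightarrow> sat M ((val M as)(length as := x)) ?\<tau>"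
    unfolding step_def by (intro sat_cong) auto
  then show ?thesis by (simp only: sat_select1)
qed

lemma select_bounds:
  "wf_form \<sigma> (select (basis n m) Q) \<and> fvs (select (basis n m) Q) \<subseteq> {..<m}"
  using selections_bounds[OF select_in_selections] basis_bounds by blast

text \<open>The forth property: the formula isolating the type of the extended tuple is a selection,
  so its existential quantification is a basis formula one level up.\<close>

lemma element_match:
  assumes "same_type (Suc n) M as N bs" "a \<in> universe M"
  shows "\<exists>b\<in>universe N. same_type n M (as @ [a]) N (bs @ [b])"
proof -
  let ?m = "length as"
  let ?\<chi> = "select (basis n (?m + 1)) (\<lambda>t. tp n M (as @ [a]) = t)"
  have len: "length bs = ?m" using assms(1) by (simp add: same_type_def)
  have "Ex ?m ?\<chi> \<in> set (basis (Suc n) ?m)"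
    unfolding basis_Suc_iff using select_in_selections by blast
  moreover have "sat M (val M as) (Ex ?m ?\<chi>)"
    unfolding sat.simps sat_select1 using assms(2) by blast
  ultimately have "sat N (val N bs) (Ex ?m ?\<chi>)" using same_typeD[OF assms(1)] by blast
  then have "\<exists>b\<in>universe N. tp n M (as @ [a]) = tp n N (bs @ [b])"
    unfolding len[symmetric] sat.simps sat_select1 .
  then show ?thesis using len by (simp add: same_type_def)
qed

lemma same_type_reach:
  assumes eq: "same_type (Suc n) M as N bs" "set as \<subseteq> universe M" "set bs \<subseteq> universe N"
    and "u < length as" "v < length as"
    and "TC (length as) (Suc (length as)) \<psi> u v \<in> set (basis (Suc n) (length as))"
  shows "as ! v \<in> reach M (step M as \<psi>) (as ! u) \<longleftrightarrow> bs ! v \<in> reach N (step N bs \<psi>) (bs ! u)"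
proof -
  have "length bs = length as" using eq(1) by (simp add: same_type_def)
  then show ?thesis
    using same_typeD[OF eq(1) assms(6)] sat_TC_reach[of u as v M \<psi>] sat_TC_reach[of u bs v N \<psi>] assms
    by simp
qed

text \<open>
  With \<open>A\<^sub>p\<^sub>d\<close> the set of elements reached from the parameter \<open>p\<close> without passing through the
  parameter \<open>d\<close>, the set \<open>A = \<Union>\<^sub>p\<^sub>\<noteq>\<^sub>d A\<^sub>p\<^sub>d\<close> is closed under all steps: a step into \<open>d\<close> from \<open>A\<^sub>p\<^sub>d\<close>
  lands in \<open>A\<^sub>d\<^sub>p\<close>.
\<close>

lemma closure_match:
  fixes M :: "('p, 'a) frame" and N :: "('p, 'b) frame"
  assumes hN: "henkin_structure \<sigma> N"
    and as: "set as \<subseteq> universe M" and bs: "set bs \<subseteq> universe N"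
    and eq: "same_type (Suc n) M as N bs" and two: "2 \<le> card (set as)"
    and B: "B \<in> admissible N" "B \<subseteq> universe N"
    and C: "C = B \<or> C = universe N - B" "set bs \<subseteq> C"
  shows "\<exists>A. definable \<sigma> M as A \<and> set as \<subseteq> A \<and>
    (\<forall>a\<in>A. \<exists>c\<in>C. same_type n M (as @ [a]) N (bs @ [c])) \<and>
    (\<forall>a\<in>A. \<forall>a'\<in>universe M - A. \<exists>c\<in>C. \<exists>c'\<in>universe N - C.
       same_type n M (as @ [a, a']) N (bs @ [c, c']))"
proof -
  let ?m = "length as"
  have len: "length bs = ?m" using eq by (simp add: same_type_def)
  \<comment> \<open>\<open>S\<close> collects the types of pairs leaving \<open>C\<close>, and
    \<open>S1\<close> the types of elements of \<open>C\<close>; \<open>\<psi>\<close> and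
    \<open>\<tau>\<close> express that a type is not among them.\<close>
  define S where "S = {tp n N (bs @ [c, c']) | c c'. c \<in> C \<and> c' \<in> universe N - C}"
  define S1 where "S1 = {tp n N (bs @ [c]) | c. c \<in> C}"
  define \<psi> where "\<psi> = select (basis n (?m + 2)) (\<lambda>t. t \<notin> S)"
  define \<tau> where "\<tau> = select (basis n (?m + 1)) (\<lambda>t. t \<notin> S1)"
  define esc where "esc d = escape (Suc ?m) d \<psi> \<tau>" for d
  have bounds: "wf_form \<sigma> \<psi>" "fvs \<psi> \<subseteq> {..<?m + 2}" "wf_form \<sigma> \<tau>" "fvs \<tau> \<subseteq> {..<?m + 1}"
    unfolding \<psi>_def \<tau>_def using select_bounds by blast+
  have esc_bounds: "wf_form \<sigma> (esc d)" "fvs (esc d) \<subseteq> {..<?m + 2}" if "d < ?m" for d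
    using bounds that unfolding esc_def escape_def by auto
  have stepM: "step M as \<psi> x y \<longleftrightarrow> tp n M (as @ [x, y]) \<notin> S"
    "step M as \<tau> x y \<longleftrightarrow> tp n M (as @ [x]) \<notin> S1" for x y
    unfolding \<psi>_def \<tau>_def by (simp_all only: step_select1 step_select2)
  have stepN: "step N bs \<psi> x y \<longleftrightarrow> tp n N (bs @ [x, y]) \<notin> S"
    "step N bs \<tau> x y \<longleftrightarrow> tp n N (bs @ [x]) \<notin> S1" for x y
    unfolding \<psi>_def \<tau>_def by (simp_all only: step_select1 step_select2 flip: len)
  \<comment> \<open>A pair leaving \<open>C\<close> has its type in \<open>S\<close>, so it is not a
    step.\<close>
  have "closed_under N (step N bs \<psi>) C"
    unfolding closed_under_def stepN S_def by blast
  then obtain D where D: "definable \<sigma> N bs D" "set bs \<subseteq> D" "D \<subseteq> C" "closed_under N (step N bs \<psi>) D"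
    using definable_closure[OF bs B C] bounds(1,2) len by metis
  have escN: "step N bs (esc d) x y \<longleftrightarrow>
      (y \<noteq> bs ! d \<and> step N bs \<psi> x y) \<or> (y = bs ! d \<and> step N bs \<tau> x y)" if "d < ?m" for d x y
    using step_escape[of d bs N \<psi> \<tau> x y] that len by (simp add: esc_def)
  have escM: "step M as (esc d) x y \<longleftrightarrow>
      (y \<noteq> as ! d \<and> step M as \<psi> x y) \<or> (y = as ! d \<and> step M as \<tau> x y)" if "d < ?m" for d x y
    using step_escape[of d as M \<psi> \<tau> x y] that by (simp add: esc_def)
  have avoidN: "bs ! d \<notin> reach N (step N bs (esc d)) (bs ! p)"
    if "p < ?m" "d < ?m" "bs ! p \<noteq> bs ! d" for p d
  proof -
    \<comment> \<open>This set is the admissible witness that the target is not reached: its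
      elements lie in \<open>C\<close>, so \<open>\<tau>\<close> fails at them and nothing leads to
      \<open>bs ! d\<close>, while steps elsewhere stay in \<open>D\<close>.\<close>
    have adm: "D - {bs ! d} \<in> admissible N"
      using definable_admissible[OF hN bs] definable_remove[OF D(1)] that len by simp
    have in_D: "bs ! p \<in> D - {bs ! d}" using that D(2) len by auto
    have cl: "closed_under N (step N bs (esc d)) (D - {bs ! d})"
      unfolding closed_under_def
    proof (intro ballI impI)
      fix x y assume xy: "x \<in> universe N" "y \<in> universe N"
        "x \<in> D - {bs ! d} \<and> step N bs (esc d) x y"
      have "\<not> step N bs \<tau> x y" using D(3) xy(3) unfolding stepN(2) S1_def by blast
      then have "y \<noteq> bs ! d" "step N bs \<psi> x y" using xy(3) escN[OF that(2)] by blast+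
      then show "y \<in> D - {bs ! d}" using closed_underD[OF D(4) xy(1,2)] xy(3) by blast
    qed
    show ?thesis using reach_subset[OF adm in_D cl] by blast
  qed
  have avoidM: "as ! d \<notin> reach M (step M as (esc d)) (as ! p)"
    if "p < ?m" "d < ?m" "as ! p \<noteq> as ! d" for p d
  proof -
    \<comment> \<open>That the target is not reached is the negation of a basis formula of level
      \<open>Suc n\<close>, hence passes from \<open>N\<close> to \<open>M\<close>.\<close>
    have "TC ?m (Suc ?m) (esc d) p d \<in> set (basis (Suc n) ?m)"
      unfolding esc_def basis_Suc_iff \<psi>_def \<tau>_def using that select_in_selections lessThan_iff
      by blast
    then show ?thesis
      using same_type_reach[OF eq as bs that(1,2)] avoidN[OF that(1,2)]
        same_type_eq_iff[OF eq that(1,2)] that(3) by blast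
  qed
  define I where "I = {(p, d). p < ?m \<and> d < ?m \<and> as ! p \<noteq> as ! d}"
  define A where "A = (\<Union>(p, d)\<in>I. reach M (step M as (esc d)) (as ! p))"
  have in_A: "x \<in> A \<longleftrightarrow> (\<exists>p d. p < ?m \<and> d < ?m \<and> as ! p \<noteq> as ! d \<and>
      x \<in> reach M (step M as (esc d)) (as ! p))" for x
    unfolding A_def I_def by blast
  have "finite I" by (rule finite_subset[of _ "{..<?m} \<times> {..<?m}"]) (auto simp: I_def)
  then have defA: "definable \<sigma> M as A"
    unfolding A_def by (intro definable_Union) (auto simp: I_def intro!: definable_reach esc_bounds)
  have asA: "as ! p \<in> A" if "p < ?m" for p
  proof -
    \<comment> \<open>Every parameter needs a different one as target in order to contribute its
      reachable set to \<open>A\<close>.\<close>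
    have "\<exists>x\<in>set as. x \<noteq> as ! p"
    proof (rule ccontr)
      assume "\<not> ?thesis"
      then have "set as \<subseteq> {as ! p}" by blast
      then have "card (set as) \<le> 1" using card_mono[of "{as ! p}" "set as"] by simp
      then show False using two by simp
    qed
    then obtain d where "d < ?m" "as ! d \<noteq> as ! p" by (auto simp: in_set_conv_nth)
    moreover have "as ! p \<in> universe M" using as that by auto
    ultimately show ?thesis using that reach_self unfolding in_A by metis
  qed
  then have "set as \<subseteq> A" by (auto simp: in_set_conv_nth)
  have UA: "A \<subseteq> universe M" using definable_subset[OF defA] .
  have one: "\<exists>c\<in>C. same_type n M (as @ [a]) N (bs @ [c])" if "a \<in> A" for a
  proof (rule ccontr)
    assume "\<not> ?thesis"
    \<comment> \<open>An element of forbidden type would make a \<open>\<tau>\<close>-step to the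
      target, contradicting \<open>avoidM\<close>.\<close>
    then have "tp n M (as @ [a]) \<notin> S1" unfolding S1_def same_type_def using len by auto
    moreover obtain p d where pd: "p < ?m" "d < ?m" "as ! p \<noteq> as ! d"
      "a \<in> reach M (step M as (esc d)) (as ! p)"
      using \<open>a \<in> A\<close> in_A by blast
    ultimately have "step M as (esc d) a (as ! d)" using escM stepM(2) by blast
    moreover have "as ! d \<in> universe M" using pd(2) as by auto
    ultimately have "as ! d \<in> reach M (step M as (esc d)) (as ! p)"
      using closed_underD[OF closed_under_reach _ _ pd(4)] UA that by blast
    then show False using avoidM pd by blast
  qed
  have pair: "\<exists>c\<in>C. \<exists>c'\<in>universe N - C. same_type n M (as @ [a, a']) N (bs @ [c, c'])"
    if "a \<in> A" "a' \<in> universe M - A" for a a'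
  proof (rule ccontr)
    assume "\<not> ?thesis"
    then have "tp n M (as @ [a, a']) \<notin> S" unfolding S_def same_type_def using len by auto
    then have st: "step M as \<psi> a a'" using stepM(1) by blast
    obtain p d where pd: "p < ?m" "d < ?m" "as ! p \<noteq> as ! d"
      "a \<in> reach M (step M as (esc d)) (as ! p)"
      using \<open>a \<in> A\<close> in_A by blast
    \<comment> \<open>All parameters lie in \<open>A\<close> and \<open>a'\<close> does not; so the
      step to \<open>a'\<close> misses the target and is a step of the escaping relation.\<close>
    have "a' \<noteq> as ! d" using asA[OF pd(2)] that(2) by auto
    then have "step M as (esc d) a a'" using escM[OF pd(2)] st by blast
    then have "a' \<in> reach M (step M as (esc d)) (as ! p)"
      using closed_underD[OF closed_under_reach _ _ pd(4)] UA that by blast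
    then show False using in_A pd that(2) by blast
  qed
  show ?thesis using defA \<open>set as \<subseteq> A\<close> one pair by blast
qed

subsection \<open>Answering a set by a set\<close>

text \<open>The invariant of the game on one component. Two distinct parameters are demanded on both
  sides at once because sets are answered in both directions.\<close>

definition position :: "nat \<Rightarrow> ('p, 'a) frame \<Rightarrow> 'a list \<Rightarrow> ('p, 'b) frame \<Rightarrow> 'b list \<Rightarrow> bool" where
  "position n M as N bs \<longleftrightarrow>
     set as \<subseteq> universe M \<and> set bs \<subseteq> universe N \<and> same_type n M as N bs \<and>
     (is_singleton (universe M) \<and> is_singleton (universe N) \<or>
      2 \<le> card (set as) \<and> 2 \<le> card (set bs))"

text \<open>Sets of matched pairs are compared rather than lists, so that the order in which
  elements are added is immaterial.\<close>

definition extends ::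
  "nat \<Rightarrow> ('p, 'a) frame \<Rightarrow> 'a list \<Rightarrow> ('p, 'b) frame \<Rightarrow> 'b list \<Rightarrow> ('a \<times> 'b) set \<Rightarrow> bool" where
  "extends n M as N bs X \<longleftrightarrow>
     (\<exists>as' bs'. position n M as' N bs' \<and> set (zip as bs) \<union> X \<subseteq> set (zip as' bs'))"

lemma position_sym: "position n M as N bs \<Longrightarrow> position n N bs M as"
  by (auto simp: position_def same_type_sym)

lemma set_zip_swap: "(a, b) \<in> set (zip xs ys) \<longleftrightarrow> (b, a) \<in> set (zip ys xs)"
  by (auto simp: in_set_zip)

lemma extends_mono: "extends n M as N bs X \<Longrightarrow> Y \<subseteq> X \<Longrightarrow> extends n M as N bs Y"
  unfolding extends_def by blast

lemma position_Suc: "position (Suc n) M as N bs \<Longrightarrow> position n M as N bs"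
  by (auto simp: position_def same_type_Suc)

lemma extendsI:
  assumes "position l M as N bs" "same_type n M (as @ xs) N (bs @ ys)"
    and "set xs \<subseteq> universe M" "set ys \<subseteq> universe N"
  shows "extends n M as N bs (set (zip xs ys))"
proof -
  have len: "length as = length bs" using assms(1) by (simp add: position_def same_type_def)
  have "card (set as) \<le> card (set (as @ xs))" "card (set bs) \<le> card (set (bs @ ys))"
    by (auto intro!: card_mono)
  then have "position n M (as @ xs) N (bs @ ys)" using assms by (auto simp: position_def)
  then show ?thesis unfolding extends_def using len by (intro exI) auto
qed

lemma element_extends:
  assumes "position (Suc n) M as N bs" "a \<in> universe M"
  shows "\<exists>b\<in>universe N. extends n M as N bs {(a, b)}"
proof -
  obtain b where "b \<in> universe N" "same_type n M (as @ [a]) N (bs @ [b])"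
    using element_match[of n M as N bs a] assms unfolding position_def by blast
  then show ?thesis using extendsI[OF assms(1), of n "[a]" "[b]"] assms(2) by auto
qed

lemma admissible_Diff:
  assumes "henkin_structure \<sigma> M" "set as \<subseteq> universe M" "definable \<sigma> M as A"
  shows "universe M - A \<in> admissible M"
  using definable_admissible[OF assms(1,2)] definable_compl[OF assms(3)] by blast

text \<open>\<open>A\<close> consists of the elements reached by steps from the parameters in
  \<open>B\<close>. Plain steps suffice: when parameters lie on both sides of \<open>B\<close>,
  single elements are answered through pairs with a parameter on the opposite side.\<close>

lemma mixed_match:
  fixes M :: "('p, 'a) frame" and N :: "('p, 'b) frame"
  assumes as: "set as \<subseteq> universe M" and bs: "set bs \<subseteq> universe N"
    and eq: "same_type (Suc n) M as N bs"
    and B: "B \<in> admissible N"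
  shows "\<exists>A. definable \<sigma> M as A \<and> (\<forall>j<length as. as ! j \<in> A \<longleftrightarrow> bs ! j \<in> B) \<and>
    (\<forall>a\<in>A. \<forall>a'\<in>universe M - A. \<exists>b\<in>B. \<exists>b'\<in>universe N - B.
       same_type n M (as @ [a, a']) N (bs @ [b, b']))"
proof -
  let ?m = "length as"
  have len: "length bs = ?m" using eq by (simp add: same_type_def)
  define S where "S = {tp n N (bs @ [c, c']) | c c'. c \<in> B \<and> c' \<in> universe N - B}"
  define \<psi> where "\<psi> = select (basis n (?m + 2)) (\<lambda>t. t \<notin> S)"
  have bounds: "wf_form \<sigma> \<psi>" "fvs \<psi> \<subseteq> {..<?m + 2}"
    unfolding \<psi>_def using select_bounds by blast+
  have stepM: "step M as \<psi> x y \<longleftrightarrow> tp n M (as @ [x, y]) \<notin> S" for x y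
    unfolding \<psi>_def by (simp only: step_select2)
  have stepN: "step N bs \<psi> x y \<longleftrightarrow> tp n N (bs @ [x, y]) \<notin> S" for x y
    unfolding \<psi>_def by (simp only: step_select2 flip: len)
  have closedN: "closed_under N (step N bs \<psi>) B"
    unfolding closed_under_def stepN S_def by blast
  define A where "A = (\<Union>p\<in>{p. p < ?m \<and> bs ! p \<in> B}. reach M (step M as \<psi>) (as ! p))"
  have defA: "definable \<sigma> M as A"
    unfolding A_def using bounds by (intro definable_Union definable_reach) auto
  have closedA: "closed_under M (step M as \<psi>) A"
    unfolding A_def by (intro closed_under_Union closed_under_reach)
  have "as ! j \<in> A \<longleftrightarrow> bs ! j \<in> B" if "j < ?m" for j
  proof
    assume "bs ! j \<in> B"
    moreover have "as ! j \<in> universe M" using as that by auto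
    ultimately show "as ! j \<in> A" unfolding A_def using reach_self that by fastforce
  next
    assume "as ! j \<in> A"
    then obtain p where p: "p < ?m" "bs ! p \<in> B" "as ! j \<in> reach M (step M as \<psi>) (as ! p)"
      unfolding A_def by blast
    \<comment> \<open>Reachability in \<open>M\<close> carries over to \<open>N\<close>, where the
      closed admissible set \<open>B\<close> traps it.\<close>
    have "TC ?m (Suc ?m) \<psi> p j \<in> set (basis (Suc n) ?m)"
      unfolding basis_Suc_iff \<psi>_def using that p(1) select_in_selections lessThan_iff by blast
    then have "bs ! j \<in> reach N (step N bs \<psi>) (bs ! p)"
      using same_type_reach[OF eq as bs p(1) that] p(3) by blast
    then show "bs ! j \<in> B" using reach_subset[OF B p(2) closedN] by blast
  qed
  moreover have "\<exists>b\<in>B. \<exists>b'\<in>universe N - B. same_type n M (as @ [a, a']) N (bs @ [b, b'])"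
    if "a \<in> A" "a' \<in> universe M - A" for a a'
  proof (rule ccontr)
    assume "\<not> ?thesis"
    then have "tp n M (as @ [a, a']) \<notin> S" unfolding S_def same_type_def using len by auto
    then have "step M as \<psi> a a'" using stepM by blast
    then show False
      using closed_underD[OF closedA] that definable_subset[OF defA] by blast
  qed
  ultimately show ?thesis using defA by blast
qed

text \<open>The condition on pairs treats two elements of one component. The two conditions on
  single elements treat elements of different components of a fusion, which are answered
  separately.\<close>

definition answers ::
  "nat \<Rightarrow> ('p, 'a) frame \<Rightarrow> 'a list \<Rightarrow> ('p, 'b) frame \<Rightarrow> 'b list \<Rightarrow> 'a set \<Rightarrow> 'b set \<Rightarrow> bool" where
  "answers n M as N bs A B \<longleftrightarrow>
     A \<in> admissible M \<and> (\<forall>(x, y)\<in>set (zip as bs). x \<in> A \<longleftrightarrow> y \<in> B) \<and>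
     (\<forall>a\<in>A. \<exists>b\<in>B. extends n M as N bs {(a, b)}) \<and>
     (\<forall>a\<in>universe M - A. \<exists>b\<in>universe N - B. extends n M as N bs {(a, b)}) \<and>
     (\<forall>a\<in>A. \<forall>a'\<in>universe M - A. \<exists>b\<in>B. \<exists>b'\<in>universe N - B. extends n M as N bs {(a, b), (a', b')})"

text \<open>The parameters lie all in \<open>B\<close>, all outside it, or on both sides. A
  parameter on the opposite side turns a single element into a pair; where there is none,
  \<open>closure_match\<close> answers the single elements on the side of the parameters.\<close>

lemma set_match:
  fixes M :: "('p, 'a) frame" and N :: "('p, 'b) frame"
  assumes hM: "henkin_structure \<sigma> M" and hN: "henkin_structure \<sigma> N"
    and pos: "position (Suc n) M as N bs" and B: "B \<in> admissible N"
  shows "\<exists>A. answers n M as N bs A B"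
proof -
  have as: "set as \<subseteq> universe M" and bs: "set bs \<subseteq> universe N"
    and eq: "same_type (Suc n) M as N bs" using pos by (auto simp: position_def)
  have len: "length bs = length as" using eq by (simp add: same_type_def)
  have BN: "B \<subseteq> universe N" using hN B by (auto simp: henkin_structure_def is_frame_def)
  have ext1: "extends n M as N bs {(a, b)}"
    if "same_type n M (as @ [a]) N (bs @ [b])" "a \<in> universe M" "b \<in> universe N" for a b
    using extendsI[OF pos that(1)] that by simp
  have ext2: "extends n M as N bs {(a, b), (a', b')}"
    if "same_type n M (as @ [a, a']) N (bs @ [b, b'])"
      "a \<in> universe M" "b \<in> universe N" "a' \<in> universe M" "b' \<in> universe N" for a b a' b'
    using extendsI[OF pos that(1)] that by simp
  show ?thesis
  proof (cases "is_singleton (universe M) \<and> is_singleton (universe N)")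
    case True
    then obtain a0 b0 where ab: "universe M = {a0}" "universe N = {b0}"
      by (auto simp: is_singleton_def)
    have ext: "extends n M as N bs {(a0, b0)}" using element_extends[OF pos, of a0] ab by auto
    \<comment> \<open>In a one-element structure \<open>B\<close> is empty or everything, and the
      answer copies this.\<close>
    define A where "A = (if B = {} then {} else universe M)"
    have "definable \<sigma> M as A"
      unfolding A_def using definable_empty definable_compl[OF definable_empty] by fastforce
    then have "A \<in> admissible M" using definable_admissible[OF hM as] by blast
    moreover have "B = {} \<or> B = {b0}" using BN ab by auto
    ultimately have "answers n M as N bs A B"
      using ext ab as bs by (auto simp: answers_def A_def dest: set_zip_leftD set_zip_rightD)
    then show ?thesis ..
  next
    case False
    then have two: "2 \<le> card (set as)" "2 \<le> card (set bs)" using pos by (auto simp: position_def)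
    then obtain c where c: "c \<in> set bs" by fastforce
    consider "set bs \<subseteq> B" | "set bs \<inter> B = {}" | "\<not> set bs \<subseteq> B" "set bs \<inter> B \<noteq> {}" by blast
    then show ?thesis
    proof cases
      case 1
      obtain A where A: "definable \<sigma> M as A" "set as \<subseteq> A"
        and one: "\<And>a. a \<in> A \<Longrightarrow> \<exists>c\<in>B. same_type n M (as @ [a]) N (bs @ [c])"
        and pair: "\<And>a a'. a \<in> A \<Longrightarrow> a' \<in> universe M - A \<Longrightarrow>
          \<exists>c\<in>B. \<exists>c'\<in>universe N - B. same_type n M (as @ [a, a']) N (bs @ [c, c'])"
        using closure_match[OF hN as bs eq two(1) B BN _ 1] by blast
      have UA: "A \<subseteq> universe M" using definable_subset[OF A(1)] .
      have p: "\<exists>b\<in>B. \<exists>b'\<in>universe N - B. extends n M as N bs {(a, b), (a', b')}"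
        if "a \<in> A" "a' \<in> universe M - A" for a a'
        using pair[OF that] ext2 that UA BN by blast
      have s: "\<exists>b\<in>universe N - B. extends n M as N bs {(a, b)}" if "a \<in> universe M - A" for a
      proof -
        \<comment> \<open>A parameter completes the single element to a pair, and is dropped again
          afterwards.\<close>
        obtain a0 where "a0 \<in> A" using two(1) A(2) by fastforce
        then show ?thesis using p[OF _ that] extends_mono[of n M as N bs] by blast
      qed
      have "answers n M as N bs A B"
        unfolding answers_def
      proof (intro conjI)
        show "\<forall>a\<in>A. \<exists>b\<in>B. extends n M as N bs {(a, b)}"
          using one ext1 UA BN by blast
        show "\<forall>(x, y)\<in>set (zip as bs). (x \<in> A) = (y \<in> B)"
          using A(2) 1 by (auto dest: set_zip_leftD set_zip_rightD)
      qed (use p s definable_admissible[OF hM as A(1)] in blast)+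
      then show ?thesis ..
    next
      case 2
      \<comment> \<open>The closure is built around the complement of \<open>B\<close>, where the
        parameters are; its complement is the answer, so pairs are read in reverse.\<close>
      let ?C = "universe N - B"
      have C: "set bs \<subseteq> ?C" "universe N - ?C = B" using 2 bs BN by auto
      obtain A where A: "definable \<sigma> M as A" "set as \<subseteq> A"
        and one: "\<And>a. a \<in> A \<Longrightarrow> \<exists>c\<in>?C. same_type n M (as @ [a]) N (bs @ [c])"
        and pair: "\<And>a a'. a \<in> A \<Longrightarrow> a' \<in> universe M - A \<Longrightarrow>
          \<exists>c\<in>?C. \<exists>c'\<in>B. same_type n M (as @ [a, a']) N (bs @ [c, c'])"
        using closure_match[OF hN as bs eq two(1) B BN _ C(1)] C(2) by auto
      have UA: "A \<subseteq> universe M" using definable_subset[OF A(1)] .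
      let ?A = "universe M - A"
      have p: "\<exists>b\<in>B. \<exists>b'\<in>?C. extends n M as N bs {(a, b), (a', b')}"
        if a: "a \<in> ?A" "a' \<in> universe M - ?A" for a a'
      proof -
        obtain b' b where b: "b' \<in> ?C" "b \<in> B" "same_type n M (as @ [a', a]) N (bs @ [b', b])"
          using pair[of a' a] a by blast
        then have "extends n M as N bs {(a', b'), (a, b)}" using ext2 a BN by blast
        then show ?thesis using b by (auto simp: insert_commute)
      qed
      have s: "\<exists>b\<in>B. extends n M as N bs {(a, b)}" if "a \<in> ?A" for a
      proof -
        obtain a0 where "a0 \<in> set as" using two(1) by fastforce
        then have "a0 \<in> universe M - ?A" using A(2) UA by blast
        then show ?thesis using p[OF that] extends_mono[of n M as N bs] by blast
      qed
      have "answers n M as N bs ?A B"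
        unfolding answers_def
      proof (intro conjI)
        show "\<forall>a\<in>universe M - ?A. \<exists>b\<in>?C. extends n M as N bs {(a, b)}"
          using one ext1 UA BN by blast
        show "\<forall>(x, y)\<in>set (zip as bs). (x \<in> ?A) = (y \<in> B)"
          using A(2) 2 by (auto dest: set_zip_leftD set_zip_rightD)
      qed (use p s admissible_Diff[OF hM as A(1)] in blast)+
      then show ?thesis ..
    next
      case 3
      obtain A where A: "definable \<sigma> M as A" "\<And>j. j < length as \<Longrightarrow> as ! j \<in> A \<longleftrightarrow> bs ! j \<in> B"
        and pair: "\<And>a a'. a \<in> A \<Longrightarrow> a' \<in> universe M - A \<Longrightarrow>
          \<exists>c\<in>B. \<exists>c'\<in>universe N - B. same_type n M (as @ [a, a']) N (bs @ [c, c'])"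
        using mixed_match[OF as bs eq B] by blast
      have UA: "A \<subseteq> universe M" using definable_subset[OF A(1)] .
      have p: "\<exists>b\<in>B. \<exists>b'\<in>universe N - B. extends n M as N bs {(a, b), (a', b')}"
        if "a \<in> A" "a' \<in> universe M - A" for a a'
        using pair[OF that] ext2 that UA BN by blast
      \<comment> \<open>One parameter on each side, to complete single elements from either side to
        pairs.\<close>
      obtain i j where ij: "i < length as" "bs ! i \<in> B" "j < length as" "bs ! j \<notin> B"
        using 3 len by (auto simp: in_set_conv_nth) (metis in_set_conv_nth)
      then have ij': "as ! i \<in> A" "as ! j \<in> universe M - A" using A(2) as by auto
      have "answers n M as N bs A B"
        unfolding answers_def
      proof (intro conjI)
        show "\<forall>a\<in>A. \<exists>b\<in>B. extends n M as N bs {(a, b)}"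
          using p[OF _ ij'(2)] extends_mono[of n M as N bs] by blast
        show "\<forall>a\<in>universe M - A. \<exists>b\<in>universe N - B. extends n M as N bs {(a, b)}"
          using p[OF ij'(1)] extends_mono[of n M as N bs] by blast
        show "\<forall>(x, y)\<in>set (zip as bs). (x \<in> A) = (y \<in> B)"
          using A(2) by (auto simp: in_set_zip)
      qed (use p definable_admissible[OF hM as A(1)] in blast)+
      then show ?thesis ..
    qed
  qed
qed

subsection \<open>Fusions\<close>

definition positions ::
  "nat \<Rightarrow> nat \<Rightarrow> (nat \<Rightarrow> ('p, 'a) frame) \<Rightarrow> (nat \<Rightarrow> 'a list) \<Rightarrow>
     (nat \<Rightarrow> ('p, 'b) frame) \<Rightarrow> (nat \<Rightarrow> 'b list) \<Rightarrow> bool" where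
  "positions k n M as N bs \<longleftrightarrow> (\<forall>i\<in>{1..k}. position n (M i) (as i) (N i) (bs i))"

text \<open>The finite partial isomorphism between the fusions, as a set of pairs.\<close>

definition matched :: "nat \<Rightarrow> (nat \<Rightarrow> 'a list) \<Rightarrow> (nat \<Rightarrow> 'b list) \<Rightarrow> ('a \<times> 'b) set" where
  "matched k as bs = (\<Union>i\<in>{1..k}. set (zip (as i) (bs i)))"

lemma positions_sym: "positions k n M as N bs \<Longrightarrow> positions k n N bs M as"
  by (simp add: positions_def position_sym)

lemma matched_swap: "(x, y) \<in> matched k as bs \<longleftrightarrow> (y, x) \<in> matched k bs as"
  unfolding matched_def UN_iff by (simp only: set_zip_swap[of x y])

lemma positions_Suc: "positions k (Suc n) M as N bs \<Longrightarrow> positions k n M as N bs"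
  by (simp add: positions_def position_Suc)

lemma positions_zip:
  assumes "positions k n M as N bs" "i \<in> {1..k}" "(x, y) \<in> set (zip (as i) (bs i))"
  shows "x \<in> universe (M i)" "y \<in> universe (N i)"
  using assms set_zip_leftD[OF assms(3)] set_zip_rightD[OF assms(3)]
  unfolding positions_def position_def by blast+

lemma disjoint_family_index:
  "disjoint_family_on U I \<Longrightarrow> i \<in> I \<Longrightarrow> j \<in> I \<Longrightarrow> x \<in> U i \<Longrightarrow> x \<in> U j \<Longrightarrow> i = j"
  unfolding disjoint_family_on_def by blast

lemma matched_component:
  assumes "positions k n M as N bs" "disjoint_family_on (\<lambda>i. universe (M i)) {1..k}"
    and "(x, y) \<in> matched k as bs" "i \<in> {1..k}" "x \<in> universe (M i)"
  shows "(x, y) \<in> set (zip (as i) (bs i))"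
proof -
  obtain j where j: "j \<in> {1..k}" "(x, y) \<in> set (zip (as j) (bs j))"
    using assms(3) unfolding matched_def by blast
  then have "i = j"
    using disjoint_family_index[OF assms(2) assms(4) j(1) assms(5)] positions_zip[OF assms(1) j] by blast
  then show ?thesis using j by blast
qed

lemma matched_universe_iff:
  assumes "positions k n M as N bs"
    and "disjoint_family_on (\<lambda>i. universe (M i)) {1..k}" "disjoint_family_on (\<lambda>i. universe (N i)) {1..k}"
    and "(x, y) \<in> matched k as bs" "i \<in> {1..k}"
  shows "x \<in> universe (M i) \<longleftrightarrow> y \<in> universe (N i)"
  using positions_zip[OF assms(1,5) matched_component[OF assms(1,2,4,5)]]
    positions_zip[OF positions_sym[OF assms(1)] assms(5)
      matched_component[OF positions_sym[OF assms(1)] assms(3) iffD1[OF matched_swap assms(4)] assms(5)]]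
  by blast

text \<open>Disjointness puts both pairs into the same component, where equality of parameters is
  part of the type.\<close>

lemma matched_eq:
  assumes "positions k n M as N bs"
    and "disjoint_family_on (\<lambda>i. universe (M i)) {1..k}"
    and "(x, y) \<in> matched k as bs" "(x', y') \<in> matched k as bs" "x = x'"
  shows "y = y'"
proof -
  obtain i where i: "i \<in> {1..k}" "(x, y) \<in> set (zip (as i) (bs i))"
    using assms(3) unfolding matched_def by blast
  have "(x', y') \<in> set (zip (as i) (bs i))"
    using matched_component[OF assms(1,2,4) i(1)] positions_zip[OF assms(1) i] assms(5) by blast
  then obtain u v where uv: "u < length (as i)" "as i ! u = x" "bs i ! u = y"
    "v < length (as i)" "as i ! v = x'" "bs i ! v = y'"
    using i(2) by (auto simp: in_set_zip)
  moreover have "same_type n (M i) (as i) (N i) (bs i)"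
    using assms(1) i(1) by (auto simp: positions_def position_def)
  ultimately show ?thesis using same_type_eq_iff assms(5) by metis
qed

lemma matched_eq_iff:
  assumes "positions k n M as N bs"
    and "disjoint_family_on (\<lambda>i. universe (M i)) {1..k}" "disjoint_family_on (\<lambda>i. universe (N i)) {1..k}"
    and "(x, y) \<in> matched k as bs" "(x', y') \<in> matched k as bs"
  shows "x = x' \<longleftrightarrow> y = y'"
  using matched_eq[OF assms(1,2,4,5)]
    matched_eq[OF positions_sym[OF assms(1)] assms(3) iffD1[OF matched_swap assms(4)]
      iffD1[OF matched_swap assms(5)]] by blast

text \<open>A tuple in a relation of \<open>M i\<close> lies in the universe of \<open>M i\<close>,
  so disjointness places all its pairs in component \<open>i\<close>; there atomic types
  agree.\<close>

lemma matched_interp: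
  assumes pos: "positions k n M as N bs" and disj: "disjoint_family_on (\<lambda>i. universe (M i)) {1..k}"
    and i: "i \<in> {1..k}" and frame: "is_frame \<sigma> (M i)"
    and R: "R \<in> set ps" "\<sigma> R = Some (length ys)"
    and m: "\<And>y. y \<in> set ys \<Longrightarrow> (h y, h' y) \<in> matched k as bs"
    and holds: "map h ys \<in> interp (M i) R"
  shows "map h' ys \<in> interp (N i) R"
proof -
  have "set (map h ys) \<subseteq> universe (M i)"
    using frame R(2) holds unfolding is_frame_def by blast
  then have "\<forall>y\<in>set ys. \<exists>v. v < length (as i) \<and> as i ! v = h y \<and> bs i ! v = h' y"
    using matched_component[OF pos disj m i] by (fastforce simp: in_set_zip)
  then obtain v where v: "\<And>y. y \<in> set ys \<Longrightarrow> v y < length (as i) \<and> as i ! v y = h y \<and> bs i ! v y = h' y"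
    by metis
  have "same_type n (M i) (as i) (N i) (bs i)" using pos i by (auto simp: positions_def position_def)
  from same_type_Rel[OF this R(1), of "map v ys"]
  have "map ((!) (as i)) (map v ys) \<in> interp (M i) R \<longleftrightarrow> map ((!) (bs i)) (map v ys) \<in> interp (N i) R"
    using R(2) v by auto
  moreover have "map ((!) (as i)) (map v ys) = map h ys" "map ((!) (bs i)) (map v ys) = map h' ys"
    using v by auto
  ultimately show ?thesis using holds by (simp only:)
qed

text \<open>Without quantifiers, agreement on atoms suffices: old symbols are compared component by
  component, and \<open>Q_i\<close> only records the component.\<close>

lemma sat_disjoint_sum_iff:
  assumes pos: "positions k n M as N bs"
    and dM: "disjoint_family_on (\<lambda>i. universe (M i)) {1..k}"
    and dN: "disjoint_family_on (\<lambda>i. universe (N i)) {1..k}"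
    and fM: "\<And>i. i \<in> {1..k} \<Longrightarrow> is_frame \<sigma> (M i)" and fN: "\<And>i. i \<in> {1..k} \<Longrightarrow> is_frame \<sigma> (N i)"
    and "quantifier_free_fo \<chi>" "wf_form (sig_star \<sigma> k) \<chi>"
    and "\<And>R. Inl R \<in> set_form \<chi> \<Longrightarrow> R \<in> set ps"
    and "\<And>x. x \<in> fvs \<chi> \<Longrightarrow> (h x, h' x) \<in> matched k as bs"
  shows "sat (disjoint_sum k M) h \<chi> \<longleftrightarrow> sat (disjoint_sum k N) h' \<chi>"
  using assms(6-9)
proof (induction \<chi>)
  case (Eq x y)
  then show ?case using matched_eq_iff[OF pos dM dN, of "h x" "h' x" "h y" "h' y"] by simp
next
  case (Rel P ys)
  have m: "(h y, h' y) \<in> matched k as bs" "(h' y, h y) \<in> matched k bs as" if "y \<in> set ys" for y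
    using Rel.prems(4)[of y] that matched_swap[of "h y" "h' y"] by auto
  show ?case
  proof (cases P)
    case (Inl R)
    then have R: "R \<in> set ps" "\<sigma> R = Some (length ys)"
      using Rel.prems by (auto simp: sig_star_def)
    have "map h ys \<in> interp (M i) R \<longleftrightarrow> map h' ys \<in> interp (N i) R" if i: "i \<in> {1..k}" for i
    proof
      assume "map h ys \<in> interp (M i) R"
      then show "map h' ys \<in> interp (N i) R"
        using matched_interp[where h = h and h' = h', OF pos dM i fM[OF i] R] m(1) by blast
    next
      assume "map h' ys \<in> interp (N i) R"
      then show "map h ys \<in> interp (M i) R"
        using matched_interp[where h = h' and h' = h, OF positions_sym[OF pos] dN i fN[OF i] R] m(2)
        by blast
    qed
    then show ?thesis using Inl by (simp add: disjoint_sum_def)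
  next
    case (Inr i)
    then have i: "i \<in> {1..k}" and "length ys = 1"
      using Rel.prems(2) by (auto simp: sig_star_def split: if_splits)
    then obtain y where "ys = [y]" by (auto simp: length_Suc_conv)
    then show ?thesis
      using Inr matched_universe_iff[OF pos dM dN m(1) i, of y] by (simp add: disjoint_sum_def)
  qed
qed auto

text \<open>The last conjunct allows another component to be extended afterwards, still from its
  original tuples.\<close>

lemma positions_extend:
  assumes "positions k n M as N bs" "i \<in> {1..k}" "extends n (M i) (as i) (N i) (bs i) X"
  shows "\<exists>as' bs'. positions k n M as' N bs' \<and> matched k as bs \<union> X \<subseteq> matched k as' bs' \<and>
    (\<forall>j. j \<noteq> i \<longrightarrow> as' j = as j \<and> bs' j = bs j)"
proof -
  obtain cs ds where cd: "position n (M i) cs (N i) ds"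
    "set (zip (as i) (bs i)) \<union> X \<subseteq> set (zip cs ds)"
    using assms(3) unfolding extends_def by blast
  have "set (zip (as j) (bs j)) \<subseteq> set (zip ((as(i := cs)) j) ((bs(i := ds)) j))" for j
    using cd(2) by auto
  moreover have "X \<subseteq> set (zip ((as(i := cs)) i) ((bs(i := ds)) i))"
    using cd(2) by auto
  ultimately have "matched k as bs \<union> X \<subseteq> matched k (as(i := cs)) (bs(i := ds))"
    using assms(2) unfolding matched_def by blast
  moreover have "positions k n M (as(i := cs)) N (bs(i := ds))"
    using assms(1) cd(1) by (auto simp: positions_def)
  ultimately show ?thesis by (intro exI[of _ "as(i := cs)"] exI[of _ "bs(i := ds)"]) simp
qed

lemma positions_element:
  assumes "positions k (Suc n) M as N bs" "a \<in> (\<Union>i\<in>{1..k}. universe (M i))"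
  shows "\<exists>b\<in>(\<Union>i\<in>{1..k}. universe (N i)). \<exists>as' bs'. positions k n M as' N bs' \<and>
    insert (a, b) (matched k as bs) \<subseteq> matched k as' bs'"
proof -
  obtain i where i: "i \<in> {1..k}" "a \<in> universe (M i)" using assms(2) by blast
  then obtain b where b: "b \<in> universe (N i)" "extends n (M i) (as i) (N i) (bs i) {(a, b)}"
    using assms(1) element_extends[of n "M i" "as i" "N i" "bs i" a] unfolding positions_def by blast
  from positions_extend[OF positions_Suc[OF assms(1)] i(1) b(2)] obtain as' bs' where
    "positions k n M as' N bs'" "matched k as bs \<union> {(a, b)} \<subseteq> matched k as' bs'" by blast
  then have "\<exists>as' bs'. positions k n M as' N bs' \<and> insert (a, b) (matched k as bs) \<subseteq> matched k as' bs'"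
    by (intro exI[of _ as'] exI[of _ bs']) simp
  then show ?thesis using b(1) i(1) by blast
qed

text \<open>A closed set testing \<open>q'\<close> is split into components, and each part is
  answered in \<open>M i\<close>. The union of the answers agrees with it on matched elements and is
  closed under \<open>R\<close>, so it tests \<open>q\<close>. The relations stay abstract so that
  the converse direction is an instance too.\<close>

lemma reach_fusion:
  assumes hM: "\<And>i. i \<in> {1..k} \<Longrightarrow> henkin_structure \<sigma> (M i)"
    and hN: "\<And>i. i \<in> {1..k} \<Longrightarrow> henkin_structure \<sigma> (N i)"
    and dM: "disjoint_family_on (\<lambda>i. universe (M i)) {1..k}"
    and dN: "disjoint_family_on (\<lambda>i. universe (N i)) {1..k}"
    and pos: "positions k (Suc n) M as N bs"
    and step: "\<And>as' bs' a a' b b'. positions k n M as' N bs' \<Longrightarrow>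
      insert (a, b) (insert (a', b') (matched k as bs)) \<subseteq> matched k as' bs' \<Longrightarrow> R a a' \<Longrightarrow> R' b b'"
    and p: "(p, p') \<in> matched k as bs" and q: "(q, q') \<in> matched k as bs"
    and reach: "q \<in> reach (fusion \<sigma> f k M) R p"
  shows "q' \<in> reach (fusion \<sigma> f k N) R' p'"
proof -
  let ?F = "fusion \<sigma> f k M" and ?G = "fusion \<sigma> f k N"
  have univ: "universe ?F = (\<Union>i\<in>{1..k}. universe (M i))" "universe ?G = (\<Union>i\<in>{1..k}. universe (N i))"
    by (simp_all add: fusion_def disjoint_sum_def)
  have adm: "admissible ?F = {(\<Union>i\<in>{1..k}. A i) | A. \<forall>i\<in>{1..k}. A i \<in> admissible (M i)}"
    "admissible ?G = {(\<Union>i\<in>{1..k}. A i) | A. \<forall>i\<in>{1..k}. A i \<in> admissible (N i)}"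
    by (simp_all add: fusion_def disjoint_sum_def)
  have subM: "X \<subseteq> universe (M i)" if "i \<in> {1..k}" "X \<in> admissible (M i)" for i X
    using hM that by (auto simp: henkin_structure_def is_frame_def)
  have subN: "X \<subseteq> universe (N i)" if "i \<in> {1..k}" "X \<in> admissible (N i)" for i X
    using hN that by (auto simp: henkin_structure_def is_frame_def)
  have "q' \<in> B" if B: "B \<in> admissible ?G" "p' \<in> B" and closed: "closed_under ?G R' B" for B
  proof -
    obtain Bi where Bi: "B = (\<Union>i\<in>{1..k}. Bi i)" "\<And>i. i \<in> {1..k} \<Longrightarrow> Bi i \<in> admissible (N i)"
      using B(1) unfolding adm by blast
    have "\<exists>A. answers n (M i) (as i) (N i) (bs i) A (Bi i)" if "i \<in> {1..k}" for i
      using set_match[OF hM[OF that] hN[OF that] _ Bi(2)[OF that]] pos that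
      unfolding positions_def by blast
    then obtain Ai where Ai: "\<And>i. i \<in> {1..k} \<Longrightarrow> answers n (M i) (as i) (N i) (bs i) (Ai i) (Bi i)"
      by metis
    let ?A = "\<Union>i\<in>{1..k}. Ai i"
    have admA: "Ai i \<in> admissible (M i)" if "i \<in> {1..k}" for i
      using Ai[OF that] unfolding answers_def by blast
    \<comment> \<open>By disjointness, membership in a union of component sets is decided in the
      component of the element.\<close>
    have in_B: "y \<in> B \<longleftrightarrow> y \<in> Bi i" if "i \<in> {1..k}" "y \<in> universe (N i)" for i y
      using disjoint_family_index[OF dN that(1) _ that(2)] subN[OF _ Bi(2)] that unfolding Bi(1) by blast
    have in_A: "x \<in> ?A \<longleftrightarrow> x \<in> Ai i" if "i \<in> {1..k}" "x \<in> universe (M i)" for i x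
      using disjoint_family_index[OF dM that(1) _ that(2)] subM[OF _ admA] that by blast
    have iff: "x \<in> ?A \<longleftrightarrow> y \<in> B" if xy: "(x, y) \<in> matched k as bs" for x y
    proof -
      obtain i where i: "i \<in> {1..k}" "(x, y) \<in> set (zip (as i) (bs i))"
        using xy unfolding matched_def by blast
      have "x \<in> Ai i \<longleftrightarrow> y \<in> Bi i" using Ai[OF i(1)] i(2) unfolding answers_def by blast
      then show ?thesis
        using in_A[OF i(1)] in_B[OF i(1)] positions_zip[OF pos i] by blast
    qed
    have "closed_under ?F R ?A"
      unfolding closed_under_def
    proof (intro ballI impI, elim conjE, rule ccontr)
      fix a a' assume a: "a \<in> universe ?F" "a' \<in> universe ?F" "a \<in> ?A" "R a a'" "a' \<notin> ?A"
      obtain i where i: "i \<in> {1..k}" "a \<in> universe (M i)" using a(1) univ by blast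
      obtain j where j: "j \<in> {1..k}" "a' \<in> universe (M j)" using a(2) univ by blast
      have ai: "a \<in> Ai i" and aj: "a' \<in> universe (M j) - Ai j"
        using a in_A[OF i] in_A[OF j] j by blast+
      have pos': "positions k n M as N bs" using positions_Suc[OF pos] .
      \<comment> \<open>A pair leaving the union is answered by a pair leaving \<open>B\<close>:
        jointly within one component, one element after the other in two components.\<close>
      have "\<exists>b b' as' bs'. b \<in> Bi i \<and> b' \<in> universe (N j) - Bi j \<and> positions k n M as' N bs' \<and>
          insert (a, b) (insert (a', b') (matched k as bs)) \<subseteq> matched k as' bs'"
      proof (cases "i = j")
        case True
        then have "a' \<in> universe (M i) - Ai i" using aj by simp
        then obtain b b' where b: "b \<in> Bi i" "b' \<in> universe (N i) - Bi i"
          "extends n (M i) (as i) (N i) (bs i) {(a, b), (a', b')}"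
          using Ai[OF i(1)] ai unfolding answers_def by blast
        from positions_extend[OF pos' i(1) b(3)] obtain as' bs' where
          "positions k n M as' N bs'" "matched k as bs \<union> {(a, b), (a', b')} \<subseteq> matched k as' bs'"
          by blast
        then show ?thesis using b(1,2) unfolding True[symmetric]
          by (intro exI[of _ b] exI[of _ b'] exI[of _ as'] exI[of _ bs']) simp
      next
        case False
        obtain b where b: "b \<in> Bi i" "extends n (M i) (as i) (N i) (bs i) {(a, b)}"
          using Ai[OF i(1)] ai unfolding answers_def by blast
        obtain b' where b': "b' \<in> universe (N j) - Bi j" "extends n (M j) (as j) (N j) (bs j) {(a', b')}"
          using Ai[OF j(1)] aj unfolding answers_def by blast
        obtain cs ds where cd: "positions k n M cs N ds" "matched k as bs \<union> {(a, b)} \<subseteq> matched k cs ds"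
          and "\<forall>l. l \<noteq> i \<longrightarrow> cs l = as l \<and> ds l = bs l"
          using positions_extend[OF pos' i(1) b(2)] by (elim exE conjE) (rule that)
        then have "cs j = as j" "ds j = bs j" using False by auto
        have "extends n (M j) (cs j) (N j) (ds j) {(a', b')}"
          using b'(2) \<open>cs j = as j\<close> \<open>ds j = bs j\<close> by simp
        from positions_extend[OF cd(1) j(1) this] obtain as' bs' where
          "positions k n M as' N bs'" "matched k cs ds \<union> {(a', b')} \<subseteq> matched k as' bs'" by blast
        moreover from this have "insert (a, b) (insert (a', b') (matched k as bs)) \<subseteq> matched k as' bs'"
          using cd(2) by blast
        ultimately show ?thesis using b(1) b'(1) by blast
      qed
      then obtain b b' where b: "b \<in> Bi i" "b' \<in> universe (N j) - Bi j" "R' b b'"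
        using step a(4) by metis
      have bN: "b \<in> universe (N i)" using subN[OF i(1) Bi(2)[OF i(1)]] b(1) by blast
      then have "b \<in> universe ?G" "b' \<in> universe ?G" using b(2) i(1) j(1) univ(2) by blast+
      moreover have "b \<in> B" using in_B[OF i(1) bN] b(1) by blast
      ultimately have "b' \<in> B" using closed_underD[OF closed] b(3) by blast
      then show False using in_B[OF j(1)] b(2) by blast
    qed
    moreover have "?A \<in> admissible ?F" using admA unfolding adm by blast
    ultimately have "q \<in> ?A" using reach iff[OF p] B(2) reach_subset[of ?A ?F p R] by blast
    then show ?thesis using iff[OF q] by blast
  qed
  moreover have "q' \<in> universe ?G"
    using q positions_zip(2)[OF pos] unfolding univ matched_def by blast
  ultimately show ?thesis unfolding reach_def by blast
qed

text \<open>In the induction each \<open>Ex\<close> or \<open>TC\<close> spends one level of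
  \<open>n\<close> and adds one or two matched elements, so \<open>n\<close> and the tuples vary.
  The list \<open>ps\<close> has to cover the old symbols in all \<open>f P\<close>, since relations
  of the fusion are evaluated in the disjoint sum.\<close>

lemma sat_fusion_iff:
  assumes f: "fusion_map \<sigma> k f"
    and hM: "\<And>i. i \<in> {1..k} \<Longrightarrow> henkin_structure \<sigma> (M i)"
    and hN: "\<And>i. i \<in> {1..k} \<Longrightarrow> henkin_structure \<sigma> (N i)"
    and dM: "disjoint_family_on (\<lambda>i. universe (M i)) {1..k}"
    and dN: "disjoint_family_on (\<lambda>i. universe (N i)) {1..k}"
    and "wf_form \<sigma> \<phi>" "qdepth \<phi> \<le> n"
    and "\<And>P R. P \<in> set_form \<phi> \<Longrightarrow> Inl R \<in> set_form (f P) \<Longrightarrow> R \<in> set ps"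
    and "positions k n M as N bs"
    and "\<And>x. x \<in> fvs \<phi> \<Longrightarrow> (g x, g' x) \<in> matched k as bs"
  shows "sat (fusion \<sigma> f k M) g \<phi> \<longleftrightarrow> sat (fusion \<sigma> f k N) g' \<phi>"
  using assms(6-10)
proof (induction \<phi> arbitrary: n as bs g g')
  case Bot
  then show ?case by simp
next
  case (Eq x y)
  then show ?case using matched_eq_iff[OF Eq.prems(4) dM dN, of "g x" "g' x" "g y" "g' y"] by simp
next
  case (Rel P xs)
  have fM: "is_frame \<sigma> (M i)" and fN: "is_frame \<sigma> (N i)" if "i \<in> {1..k}" for i
    using hM hN that by (auto simp: henkin_structure_def)
  have P: "\<sigma> P = Some (length xs)" using Rel.prems(1) by simp
  then have fP: "wf_form (sig_star \<sigma> k) (f P)" "quantifier_free_fo (f P)" "fvs (f P) \<subseteq> {..<length xs}"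
    using f unfolding fusion_map_def by blast+
  have "sat (disjoint_sum k M) (\<lambda>j. map g xs ! j) (f P) \<longleftrightarrow>
      sat (disjoint_sum k N) (\<lambda>j. map g' xs ! j) (f P)"
  proof (rule sat_disjoint_sum_iff[OF Rel.prems(4) dM dN fM fN fP(2,1)])
    show "(map g xs ! j, map g' xs ! j) \<in> matched k as bs" if "j \<in> fvs (f P)" for j
      using that fP(3) Rel.prems(5)[of "xs ! j"] by auto
    show "R \<in> set ps" if "Inl R \<in> set_form (f P)" for R
      using Rel.prems(3)[of P R] that by simp
  qed
  moreover have "g x \<in> universe (disjoint_sum k M)" "g' x \<in> universe (disjoint_sum k N)"
    if "x \<in> set xs" for x
  proof -
    have "(g x, g' x) \<in> matched k as bs" using Rel.prems(5) that by simp
    then show "g x \<in> universe (disjoint_sum k M)" "g' x \<in> universe (disjoint_sum k N)"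
      using positions_zip[OF Rel.prems(4)] unfolding matched_def disjoint_sum_def by fastforce+
  qed
  then have "g ` set xs \<subseteq> universe (disjoint_sum k M)" "g' ` set xs \<subseteq> universe (disjoint_sum k N)"
    by blast+
  ultimately show ?case using P by (simp add: fusion_def)
next
  case (Neg \<phi>)
  show ?case using Neg.IH[of n as bs g g'] Neg.prems by simp
next
  case (Conj \<phi> \<psi>)
  have "sat (fusion \<sigma> f k M) g \<phi> \<longleftrightarrow> sat (fusion \<sigma> f k N) g' \<phi>"
    by (rule Conj.IH(1)[of n as bs g g']) (use Conj.prems in auto)
  moreover have "sat (fusion \<sigma> f k M) g \<psi> \<longleftrightarrow> sat (fusion \<sigma> f k N) g' \<psi>"
    by (rule Conj.IH(2)[of n as bs g g']) (use Conj.prems in auto)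
  ultimately show ?case by simp
next
  case (Ex x \<phi>)
  obtain l where n: "n = Suc l" "qdepth \<phi> \<le> l" using Ex.prems(2) by (cases n) auto
  have pos: "positions k (Suc l) M as N bs" using Ex.prems(4) n(1) by simp
  have IH: "sat (fusion \<sigma> f k M) (g(x := a)) \<phi> \<longleftrightarrow> sat (fusion \<sigma> f k N) (g'(x := b)) \<phi>"
    if "positions k l M cs N ds" "insert (a, b) (matched k as bs) \<subseteq> matched k cs ds" for a b cs ds
  proof (rule Ex.IH[OF _ n(2) _ that(1)])
    show "((g(x := a)) z, (g'(x := b)) z) \<in> matched k cs ds" if "z \<in> fvs \<phi>" for z
      using that Ex.prems(5)[of z] \<open>insert (a, b) (matched k as bs) \<subseteq> matched k cs ds\<close> by auto
  qed (use Ex.prems(1,3) in auto)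
  have univ: "universe (fusion \<sigma> f k M) = (\<Union>i\<in>{1..k}. universe (M i))"
    "universe (fusion \<sigma> f k N) = (\<Union>i\<in>{1..k}. universe (N i))"
    by (simp_all add: fusion_def disjoint_sum_def)
  show ?case
    unfolding sat.simps univ
  proof
    assume "\<exists>a\<in>\<Union>i\<in>{1..k}. universe (M i). sat (fusion \<sigma> f k M) (g(x := a)) \<phi>"
    then obtain a where a: "a \<in> (\<Union>i\<in>{1..k}. universe (M i))" "sat (fusion \<sigma> f k M) (g(x := a)) \<phi>"
      by blast
    from positions_element[OF pos a(1)] obtain b cs ds where b: "b \<in> (\<Union>i\<in>{1..k}. universe (N i))"
      "positions k l M cs N ds" "insert (a, b) (matched k as bs) \<subseteq> matched k cs ds" by blast
    from IH[OF b(2,3)] a(2) b(1) show "\<exists>b\<in>\<Union>i\<in>{1..k}. universe (N i). sat (fusion \<sigma> f k N) (g'(x := b)) \<phi>"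
      by blast
  next
    assume "\<exists>b\<in>\<Union>i\<in>{1..k}. universe (N i). sat (fusion \<sigma> f k N) (g'(x := b)) \<phi>"
    then obtain b where b: "b \<in> (\<Union>i\<in>{1..k}. universe (N i))" "sat (fusion \<sigma> f k N) (g'(x := b)) \<phi>"
      by blast
    from positions_element[OF positions_sym[OF pos] b(1)] obtain a cs ds where
      a: "a \<in> (\<Union>i\<in>{1..k}. universe (M i))" "positions k l N ds M cs"
        "insert (b, a) (matched k bs as) \<subseteq> matched k ds cs" by blast
    have "insert (a, b) (matched k as bs) \<subseteq> matched k cs ds"
      using a(3) matched_swap[of _ _ k as bs] matched_swap[of _ _ k cs ds] by auto
    from IH[OF positions_sym[OF a(2)] this] b(2) a(1)
    show "\<exists>a\<in>\<Union>i\<in>{1..k}. universe (M i). sat (fusion \<sigma> f k M) (g(x := a)) \<phi>" by blast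
  qed
next
  case (TC x y \<phi> u v)
  obtain l where n: "n = Suc l" "qdepth \<phi> \<le> l" using TC.prems(2) by (cases n) auto
  have pos: "positions k (Suc l) M as N bs" using TC.prems(4) n(1) by simp
  let ?R = "\<lambda>a a'. sat (fusion \<sigma> f k M) (g(x := a, y := a')) \<phi>"
  let ?S = "\<lambda>b b'. sat (fusion \<sigma> f k N) (g'(x := b, y := b')) \<phi>"
  have IH: "?R a a' \<longleftrightarrow> ?S b b'"
    if cd: "positions k l M cs N ds"
      "insert (a, b) (insert (a', b') (matched k as bs)) \<subseteq> matched k cs ds" for a b a' b' cs ds
  proof (rule TC.IH[OF _ n(2) _ cd(1)])
    show "((g(x := a, y := a')) z, (g'(x := b, y := b')) z) \<in> matched k cs ds" if "z \<in> fvs \<phi>" for z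
      using that TC.prems(5)[of z] cd(2) by auto
  qed (use TC.prems(1,3) in auto)
  have IH': "?S b b' \<longleftrightarrow> ?R a a'"
    if cd: "positions k l N ds M cs"
      "insert (b, a) (insert (b', a') (matched k bs as)) \<subseteq> matched k ds cs" for a b a' b' cs ds
  proof -
    have "insert (a, b) (insert (a', b') (matched k as bs)) \<subseteq> matched k cs ds"
      using cd(2) matched_swap[of _ _ k as bs] matched_swap[of _ _ k cs ds] by auto
    from IH[OF positions_sym[OF cd(1)] this] show ?thesis ..
  qed
  have uv: "(g u, g' u) \<in> matched k as bs" "(g v, g' v) \<in> matched k as bs"
    using TC.prems(5) by auto
  then have vu: "(g' u, g u) \<in> matched k bs as" "(g' v, g v) \<in> matched k bs as"
    using matched_swap[of _ _ k as bs] by blast+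
  \<comment> \<open>\<open>reach\<close> contains only elements of the universe, a condition absent
    from the clause for \<open>TC\<close>; matched values satisfy it.\<close>
  have univ: "g v \<in> universe (fusion \<sigma> f k M)" "g' v \<in> universe (fusion \<sigma> f k N)"
    using uv(2) positions_zip[OF pos] unfolding matched_def fusion_def disjoint_sum_def by fastforce+
  \<comment> \<open>Each direction is one application of \<open>reach_fusion\<close>, the second
    with the two fusions exchanged.\<close>
  have "g v \<in> reach (fusion \<sigma> f k M) ?R (g u) \<longleftrightarrow> g' v \<in> reach (fusion \<sigma> f k N) ?S (g' u)"
  proof
    assume *: "g v \<in> reach (fusion \<sigma> f k M) ?R (g u)"
    show "g' v \<in> reach (fusion \<sigma> f k N) ?S (g' u)"
    proof (rule reach_fusion[where R = ?R and R' = ?S, OF hM hN dM dN pos _ uv *])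
      fix cs ds a a' b b'
      assume "positions k l M cs N ds" "?R a a'"
        "insert (a, b) (insert (a', b') (matched k as bs)) \<subseteq> matched k cs ds"
      then show "?S b b'" by (simp only: IH)
    qed
  next
    assume *: "g' v \<in> reach (fusion \<sigma> f k N) ?S (g' u)"
    show "g v \<in> reach (fusion \<sigma> f k M) ?R (g u)"
    proof (rule reach_fusion[where R = ?S and R' = ?R, OF hN hM dN dM positions_sym[OF pos] _ vu *])
      fix ds cs b b' a a'
      assume "positions k l N ds M cs" "?S b b'"
        "insert (b, a) (insert (b', a') (matched k bs as)) \<subseteq> matched k ds cs"
      then show "?R a a'" by (simp only: IH')
    qed
  qed
  then show ?case
    using univ by (simp only: sat.simps reach_def closed_under_def mem_Collect_eq simp_thms)
qed

section \<open>From equivalence of the components to equivalence of the fusions\<close>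

lemma two_distinct: "2 \<le> card (set xs) \<Longrightarrow> \<exists>i<length xs. \<exists>j<length xs. xs ! i \<noteq> xs ! j"
proof -
  assume "2 \<le> card (set xs)"
  then have "\<not> (\<forall>x\<in>set xs. \<forall>y\<in>set xs. x = y)"
    by (subst card_le_Suc0_iff_eq[symmetric]) auto
  then obtain x y where "x \<in> set xs" "y \<in> set xs" "x \<noteq> y" by blast
  then show ?thesis unfolding in_set_conv_nth by blast
qed

lemma tc_equiv_position:
  assumes "tc_equiv \<sigma> n (M, as) (N, bs)" "set as \<subseteq> universe M" "set bs \<subseteq> universe N"
    and "is_singleton (universe M) \<or> 2 \<le> card (set as)"
    and "is_singleton (universe N) \<or> 2 \<le> card (set bs)"
  shows "position n M as N bs"
proof -
  have len: "length as = length bs" using assms(1) by (simp add: tc_equiv_def)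
  have "sat M (val M as) \<phi> \<longleftrightarrow> sat N (val N bs) \<phi>" if "\<phi> \<in> set (basis n (length as))" for \<phi>
  proof -
    note b = basis_bounds[OF that]
    have "sat M (val M as) \<phi> \<longleftrightarrow> sat M (\<lambda>j. as ! j) \<phi>" "sat N (val N bs) \<phi> \<longleftrightarrow> sat N (\<lambda>j. bs ! j) \<phi>"
      using b len by (auto intro!: sat_cong simp: val_def)
    then show ?thesis using assms(1) b unfolding tc_equiv_def by simp
  qed
  then have eq: "same_type n M as N bs" using len by (simp add: same_type_def tp_def)
  \<comment> \<open>Distinctness of parameters is part of the type, so two distinct parameters on
    one side exclude a one-element structure on the other. Hence both structures fall under the same
    alternative of \<open>position\<close>.\<close>
  have "\<not> is_singleton (universe M)" if "2 \<le> card (set bs)"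
  proof -
    obtain i j where ij: "i < length as" "j < length as" "bs ! i \<noteq> bs ! j"
      using two_distinct[OF \<open>2 \<le> card (set bs)\<close>] len by auto
    then have "as ! i \<noteq> as ! j" "as ! i \<in> universe M" "as ! j \<in> universe M"
      using same_type_eq_iff[OF eq] assms(2) by auto
    then show ?thesis by (auto simp: is_singleton_def)
  qed
  moreover have "\<not> is_singleton (universe N)" if "2 \<le> card (set as)"
  proof -
    obtain i j where ij: "i < length as" "j < length as" "as ! i \<noteq> as ! j"
      using two_distinct[OF \<open>2 \<le> card (set as)\<close>] by auto
    then have "bs ! i \<noteq> bs ! j" "bs ! i \<in> universe N" "bs ! j \<in> universe N"
      using same_type_eq_iff[OF eq] assms(3) len by auto
    then show ?thesis by (auto simp: is_singleton_def)
  qed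
  ultimately show ?thesis using assms eq unfolding position_def by blast
qed

end

lemma finite_set_form: "finite (set_form \<phi>)"
  by (induction \<phi>) auto

lemma zip_concat_map:
  assumes "\<And>i. i \<in> set is \<Longrightarrow> length (as i) = length (bs i)"
  shows "zip (concat (map as is)) (concat (map bs is)) = concat (map (\<lambda>i. zip (as i) (bs i)) is)"
  using assms by (induction "is") auto

lemma length_concat_map:
  assumes "\<And>i. i \<in> set is \<Longrightarrow> length (as i) = length (bs i)"
  shows "length (concat (map as is)) = length (concat (map bs is))"
  using assms by (induction "is") auto

theorem theorem5p27:
  fixes \<sigma> :: "'p signature"
    and k n :: nat
    and f :: "'p \<Rightarrow> ('p + nat) form"
    and M :: "nat \<Rightarrow> ('p, 'a) frame"
    and N :: "nat \<Rightarrow> ('p, 'b) frame"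
    and m :: "nat \<Rightarrow> nat"
    and as :: "nat \<Rightarrow> 'a list"
    and bs :: "nat \<Rightarrow> 'b list"
  assumes "fusion_map \<sigma> k f"
    and "\<And>i. i \<in> {1..k} \<Longrightarrow> henkin_structure \<sigma> (M i)"
    and "\<And>i. i \<in> {1..k} \<Longrightarrow> henkin_structure \<sigma> (N i)"
    and "disjoint_family_on (\<lambda>i. universe (M i)) {1..k}"
    and "disjoint_family_on (\<lambda>i. universe (N i)) {1..k}"
    and "\<And>i. i \<in> {1..k} \<Longrightarrow> length (as i) = m i \<and> set (as i) \<subseteq> universe (M i)"
    and "\<And>i. i \<in> {1..k} \<Longrightarrow> length (bs i) = m i \<and> set (bs i) \<subseteq> universe (N i)"
    and "\<And>i. i \<in> {1..k} \<Longrightarrow> is_singleton (universe (M i)) \<or> 2 \<le> card (set (as i))"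
    and "\<And>i. i \<in> {1..k} \<Longrightarrow> is_singleton (universe (N i)) \<or> 2 \<le> card (set (bs i))"
    and "\<And>i. i \<in> {1..k} \<Longrightarrow> tc_equiv \<sigma> n (M i, as i) (N i, bs i)"
  shows "tc_equiv \<sigma> n
           (fusion \<sigma> f k M, concat (map as [1..<Suc k]))
           (fusion \<sigma> f k N, concat (map bs [1..<Suc k]))"
proof -
  let ?as = "concat (map as [1..<Suc k])" and ?bs = "concat (map bs [1..<Suc k])"
  have set_upt: "set [1..<Suc k] = {1..k}" by auto
  have lens: "length (as i) = length (bs i)" if "i \<in> set [1..<Suc k]" for i
    using assms(6,7)[of i] that unfolding set_upt by simp
  have len: "length ?as = length ?bs" using lens by (rule length_concat_map)
  have "zip ?as ?bs = concat (map (\<lambda>i. zip (as i) (bs i)) [1..<Suc k])"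
    using lens by (rule zip_concat_map)
  then have zip: "set (zip ?as ?bs) = matched k as bs"
    by (simp only: matched_def set_concat set_map set_upt image_image)
  have "sat (fusion \<sigma> f k M) (\<lambda>j. ?as ! j) \<phi> \<longleftrightarrow> sat (fusion \<sigma> f k N) (\<lambda>j. ?bs ! j) \<phi>"
    if \<phi>: "wf_form \<sigma> \<phi>" "qdepth \<phi> \<le> n" "fvs \<phi> \<subseteq> {..<length ?as}" for \<phi>
  proof -
    \<comment> \<open>The signature may be infinite, so each formula gets its own finite list: the
      old symbols in the formulas \<open>f P\<close> for the \<open>P\<close> that it
      mentions.\<close>
    have "finite (\<Union>P\<in>set_form \<phi>. {R. Inl R \<in> set_form (f P)})"
      using finite_vimageI[OF finite_set_form inj_Inl] finite_set_form by (auto simp: vimage_def)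
    then obtain ps where ps: "set ps = (\<Union>P\<in>set_form \<phi>. {R. Inl R \<in> set_form (f P)})"
      by (elim finite_list[THEN exE])
    have pos: "positions \<sigma> ps k n M as N bs"
      unfolding positions_def using assms(6-10) by (intro ballI tc_equiv_position) auto
    show ?thesis
    proof (rule sat_fusion_iff[OF assms(1-5) \<phi>(1,2) _ pos])
      show "(?as ! j, ?bs ! j) \<in> matched k as bs" if "j \<in> fvs \<phi>" for j
      proof -
        have "j < length ?as" using that \<phi>(3) by blast
        then show ?thesis unfolding zip[symmetric] in_set_zip fst_conv snd_conv using len
          by (intro exI[of _ j]) (simp only: simp_thms)
      qed
    qed (use ps in auto)
  qed
  then show ?thesis using len unfolding tc_equiv_def by blast
qed

end
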